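(* Let $X_1,X_2,\dots$ be iid real random variables with cdf $F$ and quantile function $Q=F^{-1}$, and for each $n$ let $Q_n$ be the empirical quantile function of $X_1,\dots,X_n$. Assume that $Q\in L^1(0,1)$, and that there exists an $L^1(0,1)$-valued random variable $\mathscr Q$ such that $\sqrt{n}(Q_n-Q)\rightsquigarrow\mathscr Q$ in $L^1(0,1)$. Then $Q$ is locally absolutely continuous on $(0,1)$ and satisfies $$\int_0^1\sqrt{u(1-u)}\,\mathrm{d}Q(u)<\infty .$$
   Context: $L^1(0,1)$ is the space of Lebesgue integrable functions $f:(0,1)\to\mathbb R$ (functions equal off a Lebesgue null set are identified) with norm $\lVert f\rVert_1=\int_0^1|f(u)|\,\mathrm{d}u$. The symbol $\rightsquigarrow$ denotes convergence in distribution in this metric space. For a cdf $G:\mathbb R\to[0,1]$, its quantile function is $G^{-1}:(0,1)\to\mathbb R$, $G^{-1}(u)=\inf\{x\in\mathbb R:G(x)\ge u\}$. The empirical cdf is $F_n(x)=n^{-1}\sum_{i=1}^n\mathbf 1(X_i\le x)$ and the empirical quantile function is $Q_n=F_n^{-1}$. The integral $\int_0^1\cdot\,\mathrm{d}Q$ is the Lebesgue--Stieltjes integral over the open interval $(0,1)$ with respect to the unique Radon measure $\mu_Q$ on $(0,1)$ with $\mu_Q([a,b))=Q(b)-Q(a)$ for $0<a<b<1$ ($Q$ is nondecreasing and left-continuous). $Q$ is locally absolutely continuous if its restriction to each compact subinterval of $(0,1)$ is absolutely continuous. *)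

theory Defs
  imports "HOL-Probability.Probability"
begin

section \<open>The space $L^1(0,1)$\<close>

abbreviation unit_leb :: "real measure" where
  "unit_leb \<equiv> lebesgue_on {0<..<1}"

definition L1_eq :: "(real \<Rightarrow> real) \<Rightarrow> (real \<Rightarrow> real) \<Rightarrow> bool" where
  "L1_eq f g \<longleftrightarrow> integrable unit_leb f \<and> integrable unit_leb g \<and> (AE u in unit_leb. f u = g u)"

lemma part_equivp_L1_eq: "part_equivp L1_eq"
proof (rule part_equivpI)
  show "\<exists>f. L1_eq f f"
    by (rule exI[of _ "\<lambda>_. 0"]) (simp add: L1_eq_def)
  show "symp L1_eq"
    by (rule sympI) (auto simp: L1_eq_def elim: eventually_mono)
  show "transp L1_eq"
    by (rule transpI) (auto simp: L1_eq_def elim: eventually_elim2)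
qed

text \<open>Elements are almost-everywhere classes of integrable functions; values of representatives
  outside $(0,1)$ are immaterial. \<open>abs_l1 f\<close> is the class of \<open>f\<close>, for integrable \<open>f\<close>.\<close>

quotient_type l1 = "real \<Rightarrow> real" / partial: L1_eq
  by (rule part_equivp_L1_eq)

instantiation l1 :: real_normed_vector
begin

lift_definition zero_l1 :: l1 is "\<lambda>_. 0"
  by (simp add: L1_eq_def)

lift_definition plus_l1 :: "l1 \<Rightarrow> l1 \<Rightarrow> l1" is "\<lambda>f g u. f u + g u"
  by (auto simp: L1_eq_def elim: eventually_elim2)

lift_definition minus_l1 :: "l1 \<Rightarrow> l1 \<Rightarrow> l1" is "\<lambda>f g u. f u - g u"
  by (auto simp: L1_eq_def elim: eventually_elim2)

lift_definition uminus_l1 :: "l1 \<Rightarrow> l1" is "\<lambda>f u. - f u"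
  by (auto simp: L1_eq_def elim: eventually_mono)

lift_definition scaleR_l1 :: "real \<Rightarrow> l1 \<Rightarrow> l1" is "\<lambda>c f u. c * f u"
  by (auto simp: L1_eq_def elim: eventually_mono)

lift_definition norm_l1 :: "l1 \<Rightarrow> real" is "\<lambda>f. \<integral>u. \<bar>f u\<bar> \<partial>unit_leb"
  unfolding L1_eq_def
  by (intro integral_cong_AE borel_measurable_abs borel_measurable_integrable)
     (auto elim: eventually_mono)

definition sgn_l1 :: "l1 \<Rightarrow> l1" where
  "sgn_l1 x = scaleR (inverse (norm x)) x"

definition dist_l1 :: "l1 \<Rightarrow> l1 \<Rightarrow> real" where
  "dist_l1 x y = norm (x - y)"

definition uniformity_l1 :: "(l1 \<times> l1) filter" where
  "uniformity_l1 = (INF e\<in>{0 <..}. principal {(x, y). dist x y < e})"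

definition open_l1 :: "l1 set \<Rightarrow> bool" where
  "open_l1 U \<longleftrightarrow> (\<forall>x\<in>U. eventually (\<lambda>(x', y). x' = x \<longrightarrow> y \<in> U) uniformity)"

instance
proof
  fix x y z :: l1 and a b :: real
  show "x + y + z = x + (y + z)"
    by transfer (auto simp: L1_eq_def add.assoc)
  show "x + y = y + x"
    by transfer (auto simp: L1_eq_def add.commute)
  show "0 + x = x"
    by transfer (auto simp: L1_eq_def)
  show "- x + x = 0"
    by transfer (auto simp: L1_eq_def)
  show "x - y = x + - y"
    by transfer (auto simp: L1_eq_def)
  show "a *\<^sub>R (x + y) = a *\<^sub>R x + a *\<^sub>R y"
    by transfer (auto simp: L1_eq_def distrib_left)
  show "(a + b) *\<^sub>R x = a *\<^sub>R x + b *\<^sub>R x"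
    by transfer (auto simp: L1_eq_def distrib_right)
  show "a *\<^sub>R b *\<^sub>R x = (a * b) *\<^sub>R x"
    by transfer (auto simp: L1_eq_def mult.assoc)
  show "1 *\<^sub>R x = x"
    by transfer (auto simp: L1_eq_def)
  show "(norm x = 0) = (x = 0)"
  proof transfer
    fix f assume "L1_eq f f"
    then have "integrable unit_leb f" by (simp add: L1_eq_def)
    then show "((\<integral>u. \<bar>f u\<bar> \<partial>unit_leb) = 0) = L1_eq f (\<lambda>_. 0)"
      by (subst integral_nonneg_eq_0_iff_AE) (auto simp: L1_eq_def)
  qed
  show "norm (x + y) \<le> norm x + norm y"
  proof transfer
    fix f g assume "L1_eq f f" "L1_eq g g"
    then have *: "integrable unit_leb f" "integrable unit_leb g" by (auto simp: L1_eq_def)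
    have "(\<integral>u. \<bar>f u + g u\<bar> \<partial>unit_leb) \<le> (\<integral>u. \<bar>f u\<bar> + \<bar>g u\<bar> \<partial>unit_leb)"
      using * by (intro integral_mono) auto
    also have "\<dots> = (\<integral>u. \<bar>f u\<bar> \<partial>unit_leb) + (\<integral>u. \<bar>g u\<bar> \<partial>unit_leb)"
      using * by (intro Bochner_Integration.integral_add) auto
    finally show "(\<integral>u. \<bar>f u + g u\<bar> \<partial>unit_leb)
      \<le> (\<integral>u. \<bar>f u\<bar> \<partial>unit_leb) + (\<integral>u. \<bar>g u\<bar> \<partial>unit_leb)" .
  qed
  show "norm (a *\<^sub>R x) = \<bar>a\<bar> * norm x"
    by transfer (simp add: abs_mult)
qed (simp_all add: sgn_l1_def dist_l1_def uniformity_l1_def open_l1_def)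

end

lemma dist_abs_l1:
  assumes "integrable unit_leb f" "integrable unit_leb g"
  shows "dist (abs_l1 f) (abs_l1 g) = (\<integral>u. \<bar>f u - g u\<bar> \<partial>unit_leb)"
  using assms by (simp add: dist_l1_def minus_l1.abs_eq norm_l1.abs_eq L1_eq_def)

section \<open>Convergence in distribution\<close>

definition converges_in_distribution ::
  "'a measure \<Rightarrow> (nat \<Rightarrow> 'a \<Rightarrow> 'c::metric_space) \<Rightarrow> 'b measure \<Rightarrow> ('b \<Rightarrow> 'c) \<Rightarrow> bool" where
  "converges_in_distribution M Y N Z \<longleftrightarrow>
     (\<forall>n. Y n \<in> borel_measurable M) \<and> Z \<in> borel_measurable N \<and>
     (\<forall>g :: 'c \<Rightarrow> real. continuous_on UNIV g \<longrightarrow> bounded (range g) \<longrightarrow>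
        (\<lambda>n. \<integral>\<omega>. g (Y n \<omega>) \<partial>M) \<longlonglongrightarrow> (\<integral>\<omega>. g (Z \<omega>) \<partial>N))"

section \<open>Quantile functions\<close>

definition quantile :: "(real \<Rightarrow> real) \<Rightarrow> real \<Rightarrow> real" where
  "quantile G u = Inf {x. u \<le> G x}"

text \<open>The sample is \<open>x 0, \<dots>, x (n - 1)\<close>.\<close>

definition emp_cdf :: "nat \<Rightarrow> (nat \<Rightarrow> real) \<Rightarrow> real \<Rightarrow> real" where
  "emp_cdf n x t = (\<Sum>i<n. indicator {..t} (x i)) / real n"

definition emp_quantile :: "nat \<Rightarrow> (nat \<Rightarrow> real) \<Rightarrow> real \<Rightarrow> real" where
  "emp_quantile n x = quantile (emp_cdf n x)"

lemma quantile_le_iff: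
  assumes mono: "mono G" and cont: "\<And>x. continuous (at_right x) G"
    and ex: "G y < u" "u \<le> G z"
  shows "quantile G u \<le> x \<longleftrightarrow> u \<le> G x"
proof -
  let ?S = "{x. u \<le> G x}"
  have bdd: "bdd_below ?S"
    using ex mono by (intro bdd_belowI[of _ y]) (metis linorder_le_cases mem_Collect_eq monoD not_le order_trans)
  have le: "quantile G u \<le> x" if "u \<le> G x" for x
    unfolding quantile_def using bdd that by (intro cInf_lower) auto
  have above: "u \<le> G t" if "quantile G u < t" for t
  proof -
    have "\<exists>s\<in>?S. s < t"
      using that ex bdd unfolding quantile_def by (subst (asm) cInf_less_iff) auto
    then show ?thesis
      using monoD[OF mono] by (metis less_imp_le mem_Collect_eq order_trans)
  qed
  have "u \<le> G (quantile G u)"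
  proof (rule tendsto_lowerbound)
    show "(G \<longlongrightarrow> G (quantile G u)) (at_right (quantile G u))"
      using cont by (simp add: continuous_within)
    show "eventually (\<lambda>t. u \<le> G t) (at_right (quantile G u))"
      using above by (auto simp: eventually_at_right_field intro: gt_ex)
  qed simp
  then show ?thesis
    using le monoD[OF mono] by (metis order_trans)
qed

lemma (in real_distribution) quantile_cdf_le_iff:
  assumes "0 < u" "u < 1"
  shows "quantile (cdf M) u \<le> x \<longleftrightarrow> u \<le> cdf M x"
proof -
  have "eventually (\<lambda>y. cdf M y < u) at_bot"
    using cdf_lim_at_bot assms by (intro order_tendstoD)
  then obtain y where y: "cdf M y < u" by (metis eventually_at_bot_linorder order_refl)
  have "eventually (\<lambda>z. u < cdf M z) at_top"
    using cdf_lim_at_top_prob assms by (intro order_tendstoD)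
  then obtain z where z: "u \<le> cdf M z" by (metis eventually_at_top_linorder order_refl less_imp_le)
  show ?thesis
    using y z by (intro quantile_le_iff[where G = "cdf M"])
      (auto simp: mono_def cdf_nondecreasing cdf_is_right_cont)
qed

lemma emp_quantile_le_iff:
  assumes n: "0 < n" and u: "0 < u" "u < 1"
  shows "emp_quantile n x u \<le> t \<longleftrightarrow> u \<le> emp_cdf n x t"
  unfolding emp_quantile_def
proof (rule quantile_le_iff)
  show "mono (emp_cdf n x)"
    unfolding emp_cdf_def mono_def
    by (intro allI impI divide_right_mono sum_mono) (auto simp: indicator_def)
  show "continuous (at_right s) (emp_cdf n x)" for s
  proof -
    have "((\<lambda>t. indicator {..t} (x i) :: real) \<longlongrightarrow> indicator {..s} (x i)) (at_right s)" for i
    proof (rule tendsto_eventually, cases "x i \<le> s")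
      case True
      then show "eventually (\<lambda>t. indicator {..t} (x i) = (indicator {..s} (x i) :: real)) (at_right s)"
        by (auto simp: eventually_at_right_field intro!: exI[of _ "s + 1"])
    next
      case False
      then show "eventually (\<lambda>t. indicator {..t} (x i) = (indicator {..s} (x i) :: real)) (at_right s)"
        by (auto simp: eventually_at_right_field indicator_def intro!: exI[of _ "x i"])
    qed
    then show ?thesis
      unfolding continuous_within emp_cdf_def using n by (intro tendsto_intros) auto
  qed
  have b: "- (\<Sum>i<n. \<bar>x i\<bar>) \<le> x i" "x i \<le> (\<Sum>i<n. \<bar>x i\<bar>)" if "i < n" for i
    using member_le_sum[of i "{..<n}" "\<lambda>i. \<bar>x i\<bar>"] that by auto
  have "emp_cdf n x (- (\<Sum>i<n. \<bar>x i\<bar>) - 1) = 0"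
    unfolding emp_cdf_def using b(1) by (force simp: indicator_def intro!: sum.neutral)
  then show "emp_cdf n x (- (\<Sum>i<n. \<bar>x i\<bar>) - 1) < u"
    using u by simp
  have "emp_cdf n x (\<Sum>i<n. \<bar>x i\<bar>) = 1"
    unfolding emp_cdf_def using b(2) n by simp
  then show "u \<le> emp_cdf n x (\<Sum>i<n. \<bar>x i\<bar>)"
    using u by simp
qed

lemma emp_quantile_diff_le:
  assumes n: "0 < n" and u: "0 < u" "u < 1" and d: "\<And>i. i < n \<Longrightarrow> \<bar>x i - y i\<bar> \<le> d"
  shows "\<bar>emp_quantile n x u - emp_quantile n y u\<bar> \<le> d"
proof -
  have "emp_quantile n y u \<le> emp_quantile n x u + d"
    if d: "\<And>i. i < n \<Longrightarrow> \<bar>x i - y i\<bar> \<le> d" for x y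
  proof -
    have "u \<le> emp_cdf n x (emp_quantile n x u)"
      using emp_quantile_le_iff[OF n u] by blast
    also have "\<dots> \<le> emp_cdf n y (emp_quantile n x u + d)"
      unfolding emp_cdf_def using d
      by (intro divide_right_mono sum_mono) (force simp: indicator_def abs_le_iff)+
    finally show ?thesis
      using emp_quantile_le_iff[OF n u] by blast
  qed
  from this[of x y] this[of y x] d show ?thesis
    by (force simp: abs_le_iff)
qed

lemma integrable_emp_quantile: "integrable unit_leb (emp_quantile n x)"
proof (cases "n = 0")
  case True
  then have "integrable unit_leb (emp_quantile n x) \<longleftrightarrow> integrable unit_leb (\<lambda>u. Inf {} :: real)"
    by (intro Bochner_Integration.integrable_cong) (auto simp: emp_quantile_def quantile_def emp_cdf_def)
  then show ?thesis by (simp add: finite_measure.integrable_const finite_measure_lebesgue_on)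
next
  case False
  then have n: "0 < n" by simp
  have "mono_on {0<..<1} (emp_quantile n x)"
  proof (rule mono_onI)
    fix r s :: real assume "r \<in> {0<..<1}" "s \<in> {0<..<1}" "r \<le> s"
    then show "emp_quantile n x r \<le> emp_quantile n x s"
      using emp_quantile_le_iff[OF n] by (meson greaterThanLessThan_iff order_refl order_trans)
  qed
  then have "emp_quantile n x \<in> borel_measurable (restrict_space borel {0<..<1})"
    by (intro borel_measurable_mono_on_fnc)
  then have meas: "emp_quantile n x \<in> borel_measurable unit_leb"
    by (auto simp: measurable_def space_restrict_space sets_restrict_space)
  have "emp_quantile n (\<lambda>_. 0) u = 0" if u: "0 < u" "u < 1" for u
  proof -
    have "emp_quantile n (\<lambda>_. 0) u \<le> t \<longleftrightarrow> 0 \<le> t" for t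
      unfolding emp_quantile_le_iff[OF n u] using u n by (cases "0 \<le> t") (simp_all add: emp_cdf_def)
    from this[of 0] this[of "emp_quantile n (\<lambda>_. 0) u"] show ?thesis by simp
  qed
  then have "\<bar>emp_quantile n x u\<bar> \<le> (\<Sum>i<n. \<bar>x i\<bar>)" if "0 < u" "u < 1" for u
    using emp_quantile_diff_le[OF n that, of x "\<lambda>_. 0" "\<Sum>i<n. \<bar>x i\<bar>"] that
      member_le_sum[of _ "{..<n}" "\<lambda>i. \<bar>x i\<bar>"]
    by simp
  then show ?thesis
    by (intro finite_measure.integrable_const_bound[where B = "\<Sum>i<n. \<bar>x i\<bar>"] meas AE_I2
        finite_measure_lebesgue_on) simp_all
qed

lemma continuous_emp_quantile:
  "continuous_on UNIV (\<lambda>x. abs_l1 (emp_quantile n x))"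
proof (cases "n = 0")
  case True
  then have "emp_quantile n x = quantile (\<lambda>_. 0)" for x
    by (simp add: emp_quantile_def emp_cdf_def[abs_def])
  then show ?thesis by simp
next
  case False
  then have n: "0 < n" by simp
  have "((\<lambda>y. abs_l1 (emp_quantile n y)) \<longlongrightarrow> abs_l1 (emp_quantile n x)) (at x)" for x
  proof (rule tendstoI)
    fix e :: real assume e: "0 < e"
    have "continuous_on UNIV (\<lambda>y :: nat \<Rightarrow> real. y i)" for i
      by (rule continuous_on_product_coordinates)
    then have "((\<lambda>y. y i) \<longlongrightarrow> x i) (at x)" for i
      by (simp add: continuous_on_def)
    then have "eventually (\<lambda>y. dist (y i) (x i) < e / 2) (at x)" for i
      by (rule tendstoD) (use e in simp)
    then have "eventually (\<lambda>y. \<forall>i\<in>{..<n}. dist (y i) (x i) < e / 2) (at x)"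
      by (intro eventually_ball_finite) auto
    then show "eventually (\<lambda>y. dist (abs_l1 (emp_quantile n y)) (abs_l1 (emp_quantile n x)) < e) (at x)"
    proof eventually_elim
      case (elim y)
      have "dist (abs_l1 (emp_quantile n y)) (abs_l1 (emp_quantile n x)) =
          (\<integral>u. \<bar>emp_quantile n y u - emp_quantile n x u\<bar> \<partial>unit_leb)"
        by (intro dist_abs_l1 integrable_emp_quantile)
      also have "\<dots> \<le> (\<integral>u. e / 2 \<partial>unit_leb)"
      proof (rule integral_mono)
        fix u assume "u \<in> space unit_leb"
        then show "\<bar>emp_quantile n y u - emp_quantile n x u\<bar> \<le> e / 2"
          using elim by (intro emp_quantile_diff_le[OF n]) (auto simp: dist_real_def less_imp_le)
      qed (auto intro!: integrable_emp_quantile finite_measure.integrable_const finite_measure_lebesgue_on)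
      also have "\<dots> = e / 2"
        by (simp add: measure_restrict_space)
      finally show ?case using e by simp
    qed
  qed
  then show ?thesis by (simp add: continuous_on_def)
qed

text \<open>So the measurability required by \<^const>\<open>converges_in_distribution\<close> is automatic for
  the quantile process.\<close>

lemma measurable_quantile_process:
  assumes "\<And>i. X i \<in> borel_measurable M"
  shows "(\<lambda>\<omega>. sqrt (real n) *\<^sub>R (abs_l1 (emp_quantile n (\<lambda>i. X i \<omega>)) - abs_l1 Q)) \<in> borel_measurable M"
proof -
  have "(\<lambda>\<omega> i. X i \<omega>) \<in> borel_measurable M"
    using assms by (intro measurable_coordinatewise_then_product)
  moreover have "(\<lambda>x. sqrt (real n) *\<^sub>R (abs_l1 (emp_quantile n x) - abs_l1 Q)) \<in> borel_measurable borel"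
    by (intro borel_measurable_continuous_onI continuous_intros continuous_emp_quantile)
  ultimately show ?thesis
    by (rule measurable_compose)
qed

section \<open>The Lebesgue--Stieltjes measure of a left-continuous function on $(0,1)$\<close>

text \<open>The analogue of \<^const>\<open>interval_measure\<close> for half-open intervals \<open>{a..<b}\<close> inside the open unit
  interval; \<open>Q\<close> may be unbounded near the endpoints.\<close>

definition stieltjes01 :: "(real \<Rightarrow> real) \<Rightarrow> real measure" where
  "stieltjes01 Q =
     extend_measure {0<..<1} {(a, b). 0 < a \<and> a \<le> b \<and> b < 1}
       (\<lambda>(a, b). {a..<b}) (\<lambda>(a, b). ennreal (Q b - Q a))"

lemma space_stieltjes01: "space (stieltjes01 Q) = {0<..<1}"
  unfolding stieltjes01_def by (subst space_extend_measure) auto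

lemma sets_stieltjes01: "sets (stieltjes01 Q) = sets (restrict_space borel {0<..<1})"
proof -
  let ?\<Omega> = "{0<..<1} :: real set"
  let ?G = "(\<lambda>(a, b). {a..<b}) ` {(a, b). 0 < a \<and> a \<le> b \<and> b < (1::real)}"
  have sub: "?G \<subseteq> Pow ?\<Omega>"
    by auto
  have "?\<Omega> \<inter> {a..<b} \<in> sigma_sets ?\<Omega> ?G" for a b :: real
  proof -
    let ?c = "\<lambda>n. max a (1 / real (n + 2))" and ?d = "\<lambda>n. min b (1 - 1 / real (n + 2))"
    have "?\<Omega> \<inter> {a..<b} = (\<Union>n. {?c n..<?d n})"
    proof (intro equalityI subsetI)
      fix u assume u: "u \<in> ?\<Omega> \<inter> {a..<b}"
      then obtain n where n: "1 / real (Suc n) < min u (1 - u)"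
        using nat_approx_posE[of "min u (1 - u)"] by auto
      moreover have "1 / real (n + 2) \<le> 1 / real (Suc n)"
        by (intro divide_left_mono) auto
      ultimately show "u \<in> (\<Union>n. {?c n..<?d n})"
        using u by (intro UN_I[of n]) auto
    next
      fix u assume "u \<in> (\<Union>n. {?c n..<?d n})"
      then obtain n where n: "u \<in> {?c n..<?d n}" by blast
      moreover have "0 < 1 / real (n + 2)" by simp
      ultimately have "0 < u" "u < 1" "a \<le> u" "u < b"
        unfolding atLeastLessThan_iff max.bounded_iff min_less_iff_conj by linarith+
      then show "u \<in> ?\<Omega> \<inter> {a..<b}" by simp
    qed
    also have "\<dots> \<in> sigma_sets ?\<Omega> ?G"
    proof (rule sigma_sets.Union)
      fix n
      show "{?c n..<?d n} \<in> sigma_sets ?\<Omega> ?G"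
      proof (cases "?c n \<le> ?d n")
        case True
        moreover have "0 < ?c n" "?d n < 1" by (auto simp: less_max_iff_disj min_less_iff_disj)
        ultimately show ?thesis by (intro sigma_sets.Basic) force
      next
        case False
        then have "{?c n..<?d n} = {}" by (metis atLeastLessThan_empty linear)
        then show ?thesis by (metis sigma_sets.Empty)
      qed
    qed
    finally show ?thesis .
  qed
  then have "sigma_sets ?\<Omega> ((\<inter>) ?\<Omega> ` range (\<lambda>(a, b). {a..<b})) \<subseteq> sigma_sets ?\<Omega> ?G"
    by (intro sigma_sets_mono) auto
  moreover have "(\<inter>) ?\<Omega> ` sets borel = sigma_sets ?\<Omega> ((\<inter>) ?\<Omega> ` range (\<lambda>(a, b). {a..<b}))"
  proof -
    have *: "sets (borel :: real measure) = sigma_sets UNIV (range (\<lambda>(a, b). {a..<b}))"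
      by (subst borel_eq_atLeastLessThan) simp
    show ?thesis
      unfolding * by (rule sigma_sets_Int) (simp_all add: *[symmetric])
  qed
  moreover have "sigma_sets ?\<Omega> ?G \<subseteq> sets (restrict_space borel ?\<Omega>)"
    by (intro sets.sigma_sets_subset') (auto simp: sets_restrict_space_iff)
  ultimately show ?thesis
    unfolding stieltjes01_def sets_extend_measure[OF sub] by (auto simp: sets_restrict_space)
qed

lemma (in real_distribution) emeasure_stieltjes01_quantile:
  assumes ab: "0 < a" "a \<le> b" "b < 1"
  shows "emeasure (stieltjes01 (quantile (cdf M))) {a..<b} =
         ennreal (quantile (cdf M) b - quantile (cdf M) a)"
proof -
  let ?Q = "quantile (cdf M)"
  have meas [measurable]: "cdf M \<in> borel_measurable borel"
    by (intro borel_measurable_mono) (auto simp: mono_def cdf_nondecreasing)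
  define \<nu> where "\<nu> = distr lborel borel (cdf M)"
  have \<nu>: "emeasure \<nu> {c..<d} = ennreal (?Q d - ?Q c)" if "0 < c" "c \<le> d" "d < 1" for c d
  proof -
    have "cdf M -` {c..<d} \<inter> space lborel = {?Q c..<?Q d}"
      using quantile_cdf_le_iff[of c] quantile_cdf_le_iff[of d] that
      by (auto simp: not_le[symmetric])
    moreover have "?Q c \<le> ?Q d"
      using quantile_cdf_le_iff[of c "?Q d"] quantile_cdf_le_iff[of d "?Q d"] that by auto
    ultimately show ?thesis
      by (simp add: \<nu>_def emeasure_distr)
  qed
  have sub: "(\<lambda>(a, b). {a..<b}) ` {(a, b). 0 < a \<and> a \<le> b \<and> b < (1::real)} \<subseteq> Pow {0<..<1}"
    by auto
  have "sets (stieltjes01 ?Q) \<subseteq> sets \<nu>"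
    unfolding stieltjes01_def sets_extend_measure[OF sub]
    by (rule sets.sigma_sets_subset') (auto simp: \<nu>_def)
  then have "countably_additive (sets (stieltjes01 ?Q)) (emeasure \<nu>)"
    by (intro countably_additiveI suminf_emeasure) auto
  moreover have "positive (sets (stieltjes01 ?Q)) (emeasure \<nu>)"
    by (simp add: positive_def)
  ultimately show ?thesis
    using ab
    by (intro emeasure_extend_measure_Pair[OF stieltjes01_def, where \<mu>' = "emeasure \<nu>"] \<nu>) auto
qed

section \<open>Absolute continuity of functions\<close>

definition abs_continuous_on :: "real set \<Rightarrow> (real \<Rightarrow> real) \<Rightarrow> bool" where
  "abs_continuous_on S f \<longleftrightarrow>
     (\<forall>\<epsilon>>0. \<exists>\<delta>>0. \<forall>D :: (real \<times> real) set.
        finite D \<longrightarrow> (\<forall>(a, b)\<in>D. a \<le> b \<and> {a..b} \<subseteq> S) \<longrightarrow>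
        disjoint_family_on (\<lambda>(a, b). {a<..<b}) D \<longrightarrow>
        (\<Sum>(a, b)\<in>D. b - a) < \<delta> \<longrightarrow> (\<Sum>(a, b)\<in>D. \<bar>f b - f a\<bar>) < \<epsilon>)"

definition locally_abs_continuous01 :: "(real \<Rightarrow> real) \<Rightarrow> bool" where
  "locally_abs_continuous01 f \<longleftrightarrow> (\<forall>a b. 0 < a \<longrightarrow> a \<le> b \<longrightarrow> b < 1 \<longrightarrow> abs_continuous_on {a..b} f)"

end

(*
  Write sigma = sqrt (F (1 - F)) and let A be a set of finite measure on which sigma is bounded
  away from 0. If U is a Borel subset of (0,1) containing the eta-neighbourhood of F x for every
  x in A, then exchanging the roles of abscissa and ordinate bounds
  sqrt n * int_U |Q_n - Q| from below by int_A min (sqrt n |F_n - F|, sqrt n eta). For large n,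
  second and fourth moments of binomial sums give E min (sqrt n |F_n - F|, sigma) >= sigma / 8, and
  since min (., 1) is concave, m = int_A sigma satisfies
  E min (1, sqrt n * int_U |Q_n - Q| / m) >= 1/8. The integrand is a bounded continuous functional
  on L1, so the weak limit Z inherits E min (1, int_U |Z| / m) >= 1/8.
  With U = (0,1) this bounds m, uniformly in A, which is the integral condition. If Q were not
  absolutely continuous on [a,b], one could choose U of arbitrarily small measure while m stays
  bounded away from 0, contradicting int_U |Z| -> 0.
*)

theory Submission
  imports Defs
begin

section \<open>Truncated first moments of centered sums\<close>

text \<open>Induction on \<open>n\<close>. The partial sum \<open>S n\<close> is independent of
  \<open>\<xi> n\<close>, so mixed moments factor, and every term of the binomial expansion
  containing a first power of either one vanishes by centering. What is left are products of second
  moments and the fourth moment of a single summand.\<close>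

lemma (in prob_space) moments_centered_indep_sum:
  fixes \<xi> :: "nat \<Rightarrow> 'a \<Rightarrow> real"
  assumes indep: "indep_vars (\<lambda>_. borel) \<xi> UNIV"
    and bound: "\<And>i \<omega>. \<bar>\<xi> i \<omega>\<bar> \<le> 1"
    and mean: "\<And>i. expectation (\<xi> i) = 0"
    and var: "\<And>i. expectation (\<lambda>\<omega>. (\<xi> i \<omega>)\<^sup>2) = v"
  shows "expectation (\<lambda>\<omega>. (\<Sum>i<n. \<xi> i \<omega>)\<^sup>2) = real n * v \<and>
    expectation (\<lambda>\<omega>. (\<Sum>i<n. \<xi> i \<omega>) ^ 4) \<le> 3 * (real n * v)\<^sup>2 + real n * v"
proof -
  have [measurable]: "\<xi> i \<in> borel_measurable M" for i
    using indep unfolding indep_vars_def by simp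
  have int: "integrable M f" if [measurable]: "f \<in> borel_measurable M" and "\<And>\<omega>. \<bar>f \<omega>\<bar> \<le> B" for f :: "'a \<Rightarrow> real" and B
    using that by (intro integrable_const_bound[where B = B]) auto
  define S where "S n \<omega> = (\<Sum>i<n. \<xi> i \<omega>)" for n \<omega>
  have [measurable]: "S n \<in> borel_measurable M" for n
    unfolding S_def by measurable
  have Sb: "\<bar>S n \<omega>\<bar> \<le> real n" for n \<omega>
    unfolding S_def using sum_abs[of "\<lambda>i. \<xi> i \<omega>" "{..<n}"] sum_bounded_above[of "{..<n}" "\<lambda>i. \<bar>\<xi> i \<omega>\<bar>" 1] bound
    by (auto intro: order_trans)
  have intp: "integrable M (\<lambda>\<omega>. S n \<omega> ^ j * \<xi> n \<omega> ^ k)" for n j k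
  proof (rule int)
    fix \<omega>
    have "\<bar>S n \<omega> ^ j * \<xi> n \<omega> ^ k\<bar> \<le> real n ^ j * 1 ^ k"
      unfolding abs_mult power_abs using Sb bound by (intro mult_mono power_mono) auto
    then show "\<bar>S n \<omega> ^ j * \<xi> n \<omega> ^ k\<bar> \<le> real n ^ j" by simp
  qed simp
  have intS: "integrable M (\<lambda>\<omega>. S n \<omega> ^ j)" and int\<xi>: "integrable M (\<lambda>\<omega>. \<xi> n \<omega> ^ j)" for n j
    using intp[of n j 0] intp[of n 0 j] by simp_all
  have prod: "expectation (\<lambda>\<omega>. S n \<omega> ^ j * \<xi> n \<omega> ^ k) =
      expectation (\<lambda>\<omega>. S n \<omega> ^ j) * expectation (\<lambda>\<omega>. \<xi> n \<omega> ^ k)" for n j k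
  proof -
    have "indep_var borel (\<xi> n) borel (S n)"
      unfolding S_def using indep by (intro indep_vars_sum) (auto intro: indep_vars_subset)
    then have "indep_var borel ((\<lambda>x. x ^ k) \<circ> \<xi> n) borel ((\<lambda>x. x ^ j) \<circ> S n)"
      by (rule indep_var_compose) auto
    from indep_var_lebesgue_integral[OF this] show ?thesis
      using intS int\<xi> by (simp add: o_def mult.commute)
  qed
  have ES: "expectation (S n) = 0" for n
    unfolding S_def using int\<xi>[of _ 1] mean by simp
  have main: "expectation (\<lambda>\<omega>. S n \<omega> ^ 2) = real n * v \<and>
      expectation (\<lambda>\<omega>. S n \<omega> ^ 4) \<le> 3 * (real n * v)\<^sup>2 + real n * v"
  proof (induction n)
    case 0
    then show ?case by (simp add: S_def)
  next
    case (Suc n)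
    have "v \<ge> 0"
      using var[of 0] by (metis integral_nonneg_AE AE_I2 zero_le_power2)
    have "(\<lambda>\<omega>. S (Suc n) \<omega> ^ 2) = (\<lambda>\<omega>. S n \<omega> ^ 2 + 2 * (S n \<omega> ^ 1 * \<xi> n \<omega> ^ 1) + \<xi> n \<omega> ^ 2)"
      by (auto simp: S_def power2_sum)
    then have "expectation (\<lambda>\<omega>. S (Suc n) \<omega> ^ 2) = expectation (\<lambda>\<omega>. S n \<omega> ^ 2) + v"
      using intp[of n 1 1] intS[of n 2] int\<xi>[of n 2] prod[of n 1 1] by (simp add: mean var)
    then have 2: "expectation (\<lambda>\<omega>. S (Suc n) \<omega> ^ 2) = real (Suc n) * v"
      using Suc by (simp add: algebra_simps)
    have x4: "(x + y) ^ 4 = x ^ 4 + 4 * (x ^ 3 * y ^ 1) + 6 * (x ^ 2 * y ^ 2) + 4 * (x ^ 1 * y ^ 3) + y ^ 4"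
      for x y :: real by algebra
    have "(\<lambda>\<omega>. S (Suc n) \<omega> ^ 4) = (\<lambda>\<omega>. S n \<omega> ^ 4 + 4 * (S n \<omega> ^ 3 * \<xi> n \<omega> ^ 1) +
        6 * (S n \<omega> ^ 2 * \<xi> n \<omega> ^ 2) + 4 * (S n \<omega> ^ 1 * \<xi> n \<omega> ^ 3) + \<xi> n \<omega> ^ 4)"
      unfolding x4[symmetric] by (simp add: S_def)
    then have "expectation (\<lambda>\<omega>. S (Suc n) \<omega> ^ 4) = expectation (\<lambda>\<omega>. S n \<omega> ^ 4)
        + 4 * expectation (\<lambda>\<omega>. S n \<omega> ^ 3 * \<xi> n \<omega> ^ 1) + 6 * expectation (\<lambda>\<omega>. S n \<omega> ^ 2 * \<xi> n \<omega> ^ 2)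
        + 4 * expectation (\<lambda>\<omega>. S n \<omega> ^ 1 * \<xi> n \<omega> ^ 3) + expectation (\<lambda>\<omega>. \<xi> n \<omega> ^ 4)"
      by (simp only: Bochner_Integration.integral_add Bochner_Integration.integrable_add
          integrable_mult_right integral_mult_right_zero intp intS int\<xi>)
    also have "\<dots> = expectation (\<lambda>\<omega>. S n \<omega> ^ 4) + 6 * (real n * v * v) + expectation (\<lambda>\<omega>. \<xi> n \<omega> ^ 4)"
      unfolding prod using Suc by (simp add: mean var ES)
    \<comment> \<open>Boundedness by 1 makes the fourth power at most the square, so no separate
      fourth-moment hypothesis enters.\<close>
    also have "expectation (\<lambda>\<omega>. \<xi> n \<omega> ^ 4) \<le> expectation (\<lambda>\<omega>. \<xi> n \<omega> ^ 2)"
    proof (intro integral_mono int\<xi>)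
      fix \<omega>
      have "\<xi> n \<omega> ^ 2 \<le> 1" using bound[of n \<omega>] by (simp add: abs_square_le_1)
      then have "\<xi> n \<omega> ^ 2 * \<xi> n \<omega> ^ 2 \<le> \<xi> n \<omega> ^ 2 * 1" by (intro mult_left_mono) auto
      then show "\<xi> n \<omega> ^ 4 \<le> \<xi> n \<omega> ^ 2" by (simp add: power2_eq_square power4_eq_xxxx mult.assoc)
    qed
    also have "\<dots> = v" by (rule var)
    finally have "expectation (\<lambda>\<omega>. S (Suc n) \<omega> ^ 4) \<le>
        (3 * (real n * v)\<^sup>2 + real n * v) + 6 * (real n * v * v) + v"
      using Suc by linarith
    \<comment> \<open>The term with factor 6 is the cross term of the new square; a slack of 3 v^2
      remains.\<close>
    also have "\<dots> \<le> 3 * (real (Suc n) * v)\<^sup>2 + real (Suc n) * v"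
      by (simp add: power2_eq_square algebra_simps)
    finally show ?case using 2 by blast
  qed
  then show ?thesis unfolding S_def by blast
qed

text \<open>A polynomial minorant lets moments bound a truncated first moment from below.\<close>

lemma min_abs_one_ge_quartic: "r\<^sup>2 - r ^ 4 / 4 \<le> min \<bar>r\<bar> (1 :: real)"
proof -
  have "s\<^sup>2 - s ^ 4 / 4 \<le> min s 1" if s: "0 \<le> s" for s :: real
  proof -
    \<comment> \<open>The quartic equals 1 minus this square. The bound by \<open>s\<close> is then
      needed only on [0,1], where s^2 is at most s.\<close>
    have "0 \<le> (s\<^sup>2 / 2 - 1)\<^sup>2" by simp
    then have 1: "s\<^sup>2 - s ^ 4 / 4 \<le> 1" by (simp add: power2_eq_square power4_eq_xxxx field_simps)
    have "s\<^sup>2 - s ^ 4 / 4 \<le> s" if "s \<le> 1"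
    proof -
      have "s\<^sup>2 \<le> s"
        using mult_left_mono[OF that s] by (simp add: power2_eq_square)
      with zero_le_power[OF s, of 4] show ?thesis by linarith
    qed
    then show ?thesis using 1 by linarith
  qed
  from this[of "\<bar>r\<bar>"] show ?thesis by simp
qed

text \<open>Let c = n v and \<tau> = sqrt c. The quartic minorant is applied to the sum divided by
  \<tau>, whose second moment is 1 and whose fourth moment is at most 3 + 1/c.\<close>

lemma (in prob_space) expectation_truncated_abs_sum_ge:
  fixes \<xi> :: "nat \<Rightarrow> 'a \<Rightarrow> real"
  assumes indep: "indep_vars (\<lambda>_. borel) \<xi> UNIV"
    and bound: "\<And>i \<omega>. \<bar>\<xi> i \<omega>\<bar> \<le> 1"
    and mean: "\<And>i. expectation (\<xi> i) = 0"
    and var: "\<And>i. expectation (\<lambda>\<omega>. (\<xi> i \<omega>)\<^sup>2) = v"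
    and n: "2 \<le> real n * v"
  shows "sqrt (real n * v) / 8 \<le> expectation (\<lambda>\<omega>. min \<bar>\<Sum>i<n. \<xi> i \<omega>\<bar> (sqrt (real n * v)))"
proof -
  let ?S = "\<lambda>\<omega>. \<Sum>i<n. \<xi> i \<omega>"
  define c where "c = real n * v"
  define \<tau> where "\<tau> = sqrt c"
  have c: "2 \<le> c" using n by (simp add: c_def)
  then have \<tau>: "\<tau> > 0" "\<tau>\<^sup>2 = c" by (simp_all add: \<tau>_def)
  have \<tau>4: "\<tau> ^ 4 = c\<^sup>2" unfolding \<tau>(2)[symmetric] by simp
  have [measurable]: "\<xi> i \<in> borel_measurable M" for i
    using indep unfolding indep_vars_def by simp
  have Sb: "\<bar>?S \<omega>\<bar> \<le> real n" for \<omega>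
    using sum_abs[of "\<lambda>i. \<xi> i \<omega>" "{..<n}"] sum_bounded_above[of "{..<n}" "\<lambda>i. \<bar>\<xi> i \<omega>\<bar>" 1] bound
    by (auto intro: order_trans)
  have int: "integrable M (\<lambda>\<omega>. ?S \<omega> ^ k)" for k
    using Sb by (intro integrable_const_bound[where B = "real n ^ k"] AE_I2)
      (auto simp: power_abs intro!: power_mono)
  have mom: "expectation (\<lambda>\<omega>. ?S \<omega> ^ 2) = c" "expectation (\<lambda>\<omega>. ?S \<omega> ^ 4) \<le> 3 * c\<^sup>2 + c"
    using moments_centered_indep_sum[OF indep bound mean var, of n] by (simp_all add: c_def)
  have "\<tau> / 8 = \<tau> * (1 / 8)" by simp
  \<comment> \<open>The bracket equals 1/4 - 1/(4 c). It reaches 1/8 exactly when c is at least 2,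
    which explains the hypothesis on \<open>n\<close>.\<close>
  also have "\<dots> \<le> \<tau> * (1 - (3 * c\<^sup>2 + c) / (4 * c\<^sup>2))"
    using c \<tau> by (intro mult_left_mono) (auto simp: field_simps power2_eq_square)
  also have "\<dots> \<le> \<tau> * (expectation (\<lambda>\<omega>. ?S \<omega> ^ 2) / c - expectation (\<lambda>\<omega>. ?S \<omega> ^ 4) / (4 * c\<^sup>2))"
    using c \<tau> mom by (intro mult_left_mono diff_mono divide_right_mono) auto
  also have "\<dots> = expectation (\<lambda>\<omega>. \<tau> * (?S \<omega> ^ 2 / c - ?S \<omega> ^ 4 / (4 * c\<^sup>2)))"
    using int by simp
  also have "\<dots> \<le> expectation (\<lambda>\<omega>. min \<bar>?S \<omega>\<bar> \<tau>)"
  proof (rule integral_mono)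
    show "integrable M (\<lambda>\<omega>. min \<bar>?S \<omega>\<bar> \<tau>)"
      using \<tau> by (intro integrable_const_bound[where B = \<tau>]) auto
    fix \<omega>
    have "\<tau> * (?S \<omega> ^ 2 / c - ?S \<omega> ^ 4 / (4 * c\<^sup>2)) =
        \<tau> * ((?S \<omega> / \<tau>)\<^sup>2 - (?S \<omega> / \<tau>) ^ 4 / 4)"
      by (simp add: power_divide \<tau> \<tau>4)
    also have "\<dots> \<le> \<tau> * min \<bar>?S \<omega> / \<tau>\<bar> 1"
      using \<tau> by (intro mult_left_mono min_abs_one_ge_quartic) auto
    also have "\<dots> = min \<bar>?S \<omega>\<bar> \<tau>"
      using \<tau> by (simp add: min_mult_distrib_left abs_divide)
    finally show "\<tau> * (?S \<omega> ^ 2 / c - ?S \<omega> ^ 4 / (4 * c\<^sup>2)) \<le> min \<bar>?S \<omega>\<bar> \<tau>" .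
  qed (use int in simp)
  finally show ?thesis unfolding \<tau>_def c_def .
qed

section \<open>Area between quantile functions\<close>

lemma sigma_finite_unit_leb: "sigma_finite_measure unit_leb"
  using finite_measure_lebesgue_on[of "{0<..<1::real}"] by (simp add: finite_measure.axioms(1))

lemma borel_imp_unit_leb:
  assumes [measurable]: "f \<in> borel_measurable borel" shows "f \<in> borel_measurable unit_leb"
proof -
  have "f \<in> borel_measurable lebesgue" by (simp add: measurable_completion)
  then show ?thesis by (rule measurable_restrict_space1)
qed

text \<open>The region between the graphs of \<open>G\<close> and \<open>H\<close>, restricted to
  abscissae in \<open>A\<close> and ordinates in \<open>U\<close>, is measured in two ways by
  Tonelli. A vertical slice has length at least the truncated difference, because the part of it
  within \<eta> of \<open>H x\<close> stays in \<open>U\<close>; a horizontal slice has length at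
  most the difference of the quantiles.\<close>

lemma nn_integral_quantile_diff_ge:
  fixes G H QG QH :: "real \<Rightarrow> real"
  assumes mono: "mono G" "mono H"
    and QG: "\<And>u x. 0 < u \<Longrightarrow> u < 1 \<Longrightarrow> QG u \<le> x \<longleftrightarrow> u \<le> G x"
    and QH: "\<And>u x. 0 < u \<Longrightarrow> u < 1 \<Longrightarrow> QH u \<le> x \<longleftrightarrow> u \<le> H x"
    and [measurable]: "A \<in> sets borel" "U \<in> sets borel"
    and U: "U \<subseteq> {0<..<1}"
    and ball: "\<And>x. x \<in> A \<Longrightarrow> {H x - \<eta><..<H x + \<eta>} \<subseteq> U"
  shows "(\<integral>\<^sup>+x\<in>A. ennreal (min \<bar>G x - H x\<bar> \<eta>) \<partial>lborel) \<le> (\<integral>\<^sup>+u\<in>U. ennreal \<bar>QG u - QH u\<bar> \<partial>unit_leb)"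
proof -
  interpret L: sigma_finite_measure unit_leb by (rule sigma_finite_unit_leb)
  interpret P: pair_sigma_finite lborel unit_leb ..
  have [measurable]: "G \<in> borel_measurable borel" "H \<in> borel_measurable borel"
    using mono by (auto intro: borel_measurable_mono)
  have id [measurable]: "(\<lambda>u. u) \<in> borel_measurable unit_leb"
    by (rule borel_imp_unit_leb) simp
  have Uleb: "E \<inter> {0<..<1} \<in> sets unit_leb" if "E \<in> sets borel" for E :: "real set"
    using measurable_sets[OF id that] by (simp add: space_restrict_space Int_commute)
  \<comment> \<open>Open on the left and closed on the right, so that membership of \<open>u\<close>
    matches the equivalences between \<open>QG u \<le> x\<close> and \<open>u \<le> G x\<close>
    without boundary exceptions.\<close>
  define b where "b x = {min (G x) (H x)<..max (G x) (H x)}" for x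
  define k :: "real \<Rightarrow> real \<Rightarrow> ennreal" where "k x u = indicator A x * indicator U u * indicator (b x) u" for x u
  have [measurable]: "(\<lambda>(x, u). k x u) \<in> borel_measurable (lborel \<Otimes>\<^sub>M unit_leb)"
  proof -
    have "(\<lambda>(x, u). k x u) \<in> borel_measurable (borel \<Otimes>\<^sub>M borel)"
      unfolding k_def b_def indicator_def greaterThanAtMost_iff case_prod_beta by measurable
    moreover have "(\<lambda>p. (fst p, snd p)) \<in> (lborel \<Otimes>\<^sub>M unit_leb) \<rightarrow>\<^sub>M (borel \<Otimes>\<^sub>M borel)"
      by measurable
    ultimately have "(\<lambda>p. case_prod k (fst p, snd p)) \<in> borel_measurable (lborel \<Otimes>\<^sub>M unit_leb)"
      by (rule measurable_compose[rotated])
    then show ?thesis by simp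
  qed
  have "(\<integral>\<^sup>+x\<in>A. ennreal (min \<bar>G x - H x\<bar> \<eta>) \<partial>lborel) \<le> (\<integral>\<^sup>+x. \<integral>\<^sup>+u. k x u \<partial>unit_leb \<partial>lborel)"
  proof (rule nn_integral_mono)
    fix x :: real
    show "ennreal (min \<bar>G x - H x\<bar> \<eta>) * indicator A x \<le> (\<integral>\<^sup>+u. k x u \<partial>unit_leb)"
    proof (cases "x \<in> A \<and> 0 < \<eta>")
      case True
      \<comment> \<open>This is the part of the slice within \<eta> of \<open>H x\<close>. One of
        its endpoints is always \<open>H x\<close>, hence its length is the truncated
        difference.\<close>
      define l r where "l = max (min (G x) (H x)) (H x - \<eta>)" and "r = min (max (G x) (H x)) (H x + \<eta>)"
      have lr: "min \<bar>G x - H x\<bar> \<eta> = r - l" "l \<le> r"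
        using True by (auto simp: l_def r_def)
      have sub: "{l<..<r} \<subseteq> U" "{l<..<r} \<subseteq> b x"
        using ball[of x] True by (auto simp: l_def r_def b_def)
      have "ennreal (min \<bar>G x - H x\<bar> \<eta>) * indicator A x = emeasure lebesgue {l<..<r}"
        using lr True by simp
      also have "\<dots> = emeasure unit_leb {l<..<r}"
        using sub U by (subst emeasure_restrict_space) auto
      also have "\<dots> = (\<integral>\<^sup>+u. indicator {l<..<r} u \<partial>unit_leb)"
        using Uleb[of "{l<..<r}"] order_trans[OF sub(1) U]
        by (subst nn_integral_indicator) (simp_all add: Int_absorb2 del: Int_greaterThanLessThan)
      also have "\<dots> \<le> (\<integral>\<^sup>+u. k x u \<partial>unit_leb)"
        using sub True by (intro nn_integral_mono) (auto simp: k_def indicator_def)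
      finally show ?thesis .
    next
      case False
      then show ?thesis by (auto simp: indicator_def ennreal_neg min_def)
    qed
  qed
  also have "\<dots> = (\<integral>\<^sup>+u. \<integral>\<^sup>+x. k x u \<partial>lborel \<partial>unit_leb)"
    by (rule P.Fubini'[symmetric]) measurable
  also have "\<dots> \<le> (\<integral>\<^sup>+u\<in>U. ennreal \<bar>QG u - QH u\<bar> \<partial>unit_leb)"
  proof (rule nn_integral_mono)
    fix u :: real
    assume "u \<in> space unit_leb"
    then have u: "0 < u" "u < 1" by auto
    \<comment> \<open>The two quantile equivalences convert "\<open>u\<close> lies between
      \<open>G x\<close> and \<open>H x\<close>" into "\<open>x\<close> lies between
      \<open>QG u\<close> and \<open>QH u\<close>".\<close>
    have "k x u \<le> indicator U u * indicator {min (QG u) (QH u)..<max (QG u) (QH u)} x" for x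
      using QG[OF u, of x] QH[OF u, of x]
      by (auto simp: k_def b_def indicator_def min_le_iff_disj le_max_iff_disj min_less_iff_disj less_max_iff_disj not_le[symmetric])
    then have "(\<integral>\<^sup>+x. k x u \<partial>lborel) \<le>
        (\<integral>\<^sup>+x. indicator U u * indicator {min (QG u) (QH u)..<max (QG u) (QH u)} x \<partial>lborel)"
      by (intro nn_integral_mono)
    also have "\<dots> = indicator U u * ennreal (max (QG u) (QH u) - min (QG u) (QH u))"
      by (subst nn_integral_cmult) auto
    also have "max (QG u) (QH u) - min (QG u) (QH u) = \<bar>QG u - QH u\<bar>" by auto
    finally show "(\<integral>\<^sup>+x. k x u \<partial>lborel) \<le> ennreal \<bar>QG u - QH u\<bar> * indicator U u"
      by (simp add: mult.commute)
  qed
  finally show ?thesis .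
qed

section \<open>The mass of an element of $L^1(0,1)$ on a Borel set\<close>

text \<open>The integral of the modulus over \<open>U\<close>, written with a chosen representative;
  for Borel \<open>U\<close> any other representative gives the same value. On (0,1) it is the
  norm.\<close>

definition l1_mass :: "real set \<Rightarrow> l1 \<Rightarrow> real" where
  "l1_mass U f = (\<integral>u. indicator U u * \<bar>rep_l1 f u\<bar> \<partial>unit_leb)"

lemma integrable_rep_l1: "integrable unit_leb (rep_l1 f)"
  using Quotient_rep_reflp[OF Quotient_l1, of f] by (simp add: L1_eq_def)

lemma abs_rep_l1: "abs_l1 (rep_l1 f) = f"
  by (rule Quotient_abs_rep[OF Quotient_l1])

lemma integrable_indicator_abs:
  fixes h :: "real \<Rightarrow> real"
  assumes "U \<in> sets borel" "integrable unit_leb h"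
  shows "integrable unit_leb (\<lambda>u. indicator U u * \<bar>h u\<bar>)"
proof (rule Bochner_Integration.integrable_bound)
  show "integrable unit_leb h" by fact
  have [measurable]: "h \<in> borel_measurable unit_leb" using assms by auto
  have "(indicator U :: real \<Rightarrow> real) \<in> borel_measurable unit_leb"
    using assms by (intro borel_imp_unit_leb) auto
  then show "(\<lambda>u. indicator U u * \<bar>h u\<bar>) \<in> borel_measurable unit_leb"
    by measurable
qed (auto simp: indicator_def)

lemma l1_mass_abs_l1:
  assumes U: "U \<in> sets borel" and h: "integrable unit_leb h"
  shows "l1_mass U (abs_l1 h) = (\<integral>u. indicator U u * \<bar>h u\<bar> \<partial>unit_leb)"
proof -
  have "L1_eq (rep_l1 (abs_l1 h)) h"
    using Quotient_rep_abs[OF Quotient_l1, of h] h by (simp add: L1_eq_def)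
  then have "AE u in unit_leb. rep_l1 (abs_l1 h) u = h u" by (simp add: L1_eq_def)
  then show ?thesis
    unfolding l1_mass_def using integrable_indicator_abs[OF U] integrable_rep_l1 h
    by (intro integral_cong_AE) auto
qed

lemma l1_mass_nonneg: "0 \<le> l1_mass U f"
  unfolding l1_mass_def by (intro integral_nonneg_AE AE_I2) auto

text \<open>The reverse triangle inequality under the integral. It makes the mass a Lipschitz
  functional, so that its truncations can serve as test functions for weak convergence.\<close>

lemma l1_mass_diff_le:
  assumes U: "U \<in> sets borel"
  shows "l1_mass U f - l1_mass U g \<le> dist f g"
proof -
  have "l1_mass U f - l1_mass U g = (\<integral>u. indicator U u * \<bar>rep_l1 f u\<bar> - indicator U u * \<bar>rep_l1 g u\<bar> \<partial>unit_leb)"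
    unfolding l1_mass_def using integrable_indicator_abs[OF U integrable_rep_l1] by simp
  also have "\<dots> \<le> (\<integral>u. \<bar>rep_l1 f u - rep_l1 g u\<bar> \<partial>unit_leb)"
    using integrable_indicator_abs[OF U integrable_rep_l1] integrable_rep_l1
    by (intro integral_mono) (auto simp: indicator_def)
  also have "\<dots> = dist f g"
    using dist_abs_l1[OF integrable_rep_l1[of f] integrable_rep_l1[of g]] by (simp add: abs_rep_l1)
  finally show ?thesis .
qed

lemma continuous_on_l1_mass:
  assumes U: "U \<in> sets borel"
  shows "continuous_on S (l1_mass U)"
proof (rule continuous_onI)
  fix f e assume "(0 :: real) < e"
  moreover have "dist (l1_mass U g) (l1_mass U f) \<le> dist g f" for g
    using l1_mass_diff_le[OF U, of f g] l1_mass_diff_le[OF U, of g f]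
    by (simp add: dist_real_def abs_le_iff dist_commute)
  ultimately show "\<exists>d>0. \<forall>g\<in>S. dist g f < d \<longrightarrow> dist (l1_mass U g) (l1_mass U f) \<le> e"
    by (meson less_imp_le order_trans)
qed

text \<open>The measures are summable, so by Borel-Cantelli almost every point lies in only finitely
  many \<open>U k\<close>. The integrands then tend to 0 almost everywhere, dominated by the modulus
  of \<open>f\<close>.\<close>

lemma l1_mass_tendsto_0:
  assumes U: "\<And>k. U k \<in> sets borel" "\<And>k. U k \<subseteq> {0<..<1}"
    and small: "\<And>k. measure lborel (U k) \<le> (1/2) ^ k"
  shows "(\<lambda>k. l1_mass (U k) f) \<longlonglongrightarrow> 0"
proof -
  interpret L: finite_measure unit_leb
    by (rule finite_measure_lebesgue_on) simp
  have meq: "measure unit_leb (U k) = measure lborel (U k)" for k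
    using U[of k] by (subst measure_restrict_space) auto
  have sets: "U k \<in> sets unit_leb" for k
    using U[of k] by (auto simp: sets_restrict_space intro!: image_eqI[of _ _ "U k"])
  have ae: "AE u in unit_leb. eventually (\<lambda>k. u \<in> space unit_leb - U k) sequentially"
  proof (rule borel_cantelli_AE1[OF sets])
    show "summable (\<lambda>k. measure unit_leb (U k))"
      unfolding meq by (rule summable_comparison_test'[OF summable_geometric[of "1/2 :: real"], of 0])
        (use small in auto)
  qed (simp add: L.emeasure_eq_measure)
  have "(\<lambda>k. \<integral>u. indicator (U k) u * \<bar>rep_l1 f u\<bar> \<partial>unit_leb) \<longlonglongrightarrow> (\<integral>u. 0 \<partial>unit_leb)"
  proof (rule integral_dominated_convergence[where w = "\<lambda>u. \<bar>rep_l1 f u\<bar>"])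
    show "AE u in unit_leb. (\<lambda>k. indicator (U k) u * \<bar>rep_l1 f u\<bar>) \<longlonglongrightarrow> 0"
      using ae by eventually_elim (auto intro!: tendsto_eventually elim: eventually_mono)
  qed (use integrable_indicator_abs[OF U(1) integrable_rep_l1] integrable_rep_l1 in \<open>auto simp: indicator_def\<close>)
  then show ?thesis by (simp add: l1_mass_def)
qed

section \<open>Lower bounds for the quantile process\<close>

locale iid_sample = prob_space M for M :: "'a measure" +
  fixes X :: "nat \<Rightarrow> 'a \<Rightarrow> real" and F :: "real \<Rightarrow> real"
  assumes indep: "indep_vars (\<lambda>_. borel) X UNIV"
    and cdf_X: "\<And>i. cdf (distr M borel (X i)) = F"
begin

lemma measurable_X [measurable]: "X i \<in> borel_measurable M"
  using indep unfolding indep_vars_def by simp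

text \<open>The law of \<open>X 0\<close> represents the common law, so general facts about the cdf
  of a real distribution become facts about \<open>F\<close>.\<close>

sublocale D: real_distribution "distr M borel (X 0)"
  rewrites "cdf (distr M borel (X 0)) = F"
proof -
  show "real_distribution (distr M borel (X 0))" by (rule real_distribution_distr) simp
qed (rule cdf_X)

lemma mono_F: "mono F"
  by (simp add: mono_def D.cdf_nondecreasing)

lemma measurable_F [measurable]: "F \<in> borel_measurable borel"
  by (rule borel_measurable_mono[OF mono_F])

lemma F_nonneg: "0 \<le> F x" and F_le_1: "F x \<le> 1"
  using D.cdf_nonneg D.cdf_bounded_prob by auto

text \<open>The standard deviation of the indicator of the event that a sample value is at most
  \<open>x\<close>. It is also the integrand of the theorem evaluated at u =
  \<open>F x\<close>.\<close>

definition sd :: "real \<Rightarrow> real" where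
  "sd x = sqrt (F x * (1 - F x))"

lemma measurable_sd [measurable]: "sd \<in> borel_measurable borel"
  unfolding sd_def by measurable

lemma sd_nonneg: "0 \<le> sd x"
  unfolding sd_def using F_nonneg F_le_1 by simp

lemma sd_le_1: "sd x \<le> 1"
  unfolding sd_def using F_nonneg[of x] F_le_1[of x] mult_le_one[of "F x" "1 - F x"] by simp

section \<open>The empirical process at a fixed abscissa\<close>

definition emp_process :: "nat \<Rightarrow> 'a \<Rightarrow> real \<Rightarrow> real" where
  "emp_process n \<omega> x = sqrt (real n) * (emp_cdf n (\<lambda>i. X i \<omega>) x - F x)"

text \<open>The centered indicators of {X_i \<le> x} have variance \<open>F x * (1 - F x)\<close>,
  and their sum is \<open>sqrt (real n)\<close> times the process. Dividing by this factor turns the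
  truncation level of the moment bound into \<open>sd x\<close>.\<close>

lemma expectation_emp_process_ge:
  assumes n: "2 \<le> real n * (F x * (1 - F x))"
  shows "sd x / 8 \<le> expectation (\<lambda>\<omega>. min \<bar>emp_process n \<omega> x\<bar> (sd x))"
proof -
  define \<xi> where "\<xi> i \<omega> = indicator {..x} (X i \<omega>) - F x" for i \<omega>
  have n0: "0 < real n" using n by (cases n) auto
  have E: "expectation (\<lambda>\<omega>. indicator {..x} (X i \<omega>) :: real) = F x" for i
  proof -
    have "expectation (\<lambda>\<omega>. indicator {..x} (X i \<omega>) :: real) = (\<integral>y. indicator {..x} y \<partial>distr M borel (X i))"
      by (subst integral_distr) auto
    also have "\<dots> = cdf (distr M borel (X i)) x"
      by (simp add: cdf_def)
    finally show ?thesis by (simp add: cdf_X)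
  qed
  have int: "integrable M (\<lambda>\<omega>. indicator {..x} (X i \<omega>) :: real)" for i
    by (rule integrable_const_bound[where B = 1]) auto
  have "indep_vars (\<lambda>_. borel) \<xi> UNIV"
    unfolding \<xi>_def by (rule indep_vars_compose2[OF indep]) measurable
  moreover have "\<bar>\<xi> i \<omega>\<bar> \<le> 1" for i \<omega>
    unfolding \<xi>_def using F_nonneg[of x] F_le_1[of x] by (auto simp: indicator_def)
  moreover have "expectation (\<xi> i) = 0" for i
    unfolding \<xi>_def using int by (simp add: E prob_space)
  moreover have "expectation (\<lambda>\<omega>. (\<xi> i \<omega>)\<^sup>2) = F x * (1 - F x)" for i
  proof -
    \<comment> \<open>An indicator equals its square, so the squared summand is affine in
      it.\<close>
    have "(\<lambda>\<omega>. (\<xi> i \<omega>)\<^sup>2) = (\<lambda>\<omega>. (1 - 2 * F x) * indicator {..x} (X i \<omega>) + (F x)\<^sup>2)"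
      unfolding \<xi>_def by (auto simp: indicator_def power2_eq_square algebra_simps)
    then show ?thesis using int by (simp add: E prob_space power2_eq_square algebra_simps)
  qed
  ultimately have *: "sqrt (real n * (F x * (1 - F x))) / 8 \<le>
      expectation (\<lambda>\<omega>. min \<bar>\<Sum>i<n. \<xi> i \<omega>\<bar> (sqrt (real n * (F x * (1 - F x)))))"
    using n by (rule expectation_truncated_abs_sum_ge)
  have "(\<Sum>i<n. \<xi> i \<omega>) = sqrt (real n) * emp_process n \<omega> x" for \<omega>
    using n0 by (simp add: \<xi>_def emp_process_def emp_cdf_def sum_subtractf field_simps)
  then have "min \<bar>\<Sum>i<n. \<xi> i \<omega>\<bar> (sqrt (real n * (F x * (1 - F x)))) =
      sqrt (real n) * min \<bar>emp_process n \<omega> x\<bar> (sd x)" for \<omega>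
    by (simp add: real_sqrt_mult sd_def abs_mult min_mult_distrib_left)
  with * have "sqrt (real n) * (sd x / 8) \<le> sqrt (real n) * expectation (\<lambda>\<omega>. min \<bar>emp_process n \<omega> x\<bar> (sd x))"
    by (simp add: real_sqrt_mult sd_def)
  then show ?thesis using n0 by simp
qed

text \<open>Joint measurability in the sample point and the abscissa is what the exchange of
  expectation and integral over \<open>A\<close> requires.\<close>

lemma measurable_emp_process [measurable]:
  "(\<lambda>(\<omega>, x). emp_process n \<omega> x) \<in> borel_measurable (M \<Otimes>\<^sub>M lborel)"
proof -
  have "(\<lambda>(\<omega>, x). emp_process n \<omega> x) =
      (\<lambda>p. sqrt (real n) * ((\<Sum>i<n. if X i (fst p) \<le> snd p then 1 else 0) / real n - F (snd p)))"
    unfolding emp_process_def emp_cdf_def indicator_def of_bool_def case_prod_beta atMost_iff ..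
  then show ?thesis by simp
qed

section \<open>Expected mass of the quantile process and of its limit\<close>

lemma mono_emp_cdf: "mono (emp_cdf n x)"
  unfolding emp_cdf_def mono_def
  by (intro allI impI divide_right_mono sum_mono) (auto simp: indicator_def)

text \<open>Let \<open>T\<close> be the integral over \<open>A\<close> of the process truncated at
  \<open>sd\<close>, and \<open>mA\<close> that of \<open>sd\<close> itself. Then \<open>T\<close>
  is at most \<open>mA\<close>, and by the area comparison at most the mass of the quantile process
  on \<open>U\<close>, while its expectation is at least \<open>mA / 8\<close>. Since
  \<open>m \<le> mA\<close>, the quotient of \<open>T\<close> by \<open>mA\<close> is below the
  truncated ratio in the conclusion.\<close>

lemma expectation_l1_mass_ge:
  assumes Q: "integrable unit_leb (quantile F)"
    and A [measurable]: "A \<in> sets borel" and finA: "emeasure lborel A < \<infinity>"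
    and s: "0 < s" "\<And>x. x \<in> A \<Longrightarrow> s \<le> F x * (1 - F x)"
    and U [measurable]: "U \<in> sets borel" and U01: "U \<subseteq> {0<..<1}"
    and \<eta>: "0 < \<eta>" and ball: "\<And>x. x \<in> A \<Longrightarrow> {F x - \<eta><..<F x + \<eta>} \<subseteq> U"
    and m: "0 < m" "ennreal m \<le> (\<integral>\<^sup>+x\<in>A. ennreal (sd x) \<partial>lborel)"
  shows "eventually (\<lambda>n. 1 / 8 \<le> expectation (\<lambda>\<omega>. min 1 (l1_mass U
    (sqrt (real n) *\<^sub>R (abs_l1 (emp_quantile n (\<lambda>i. X i \<omega>)) - abs_l1 (quantile F))) / m))) sequentially"
proof -
  obtain mA where mA: "(\<integral>\<^sup>+x\<in>A. ennreal (sd x) \<partial>lborel) = ennreal mA" "0 \<le> mA"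
  proof -
    have "(\<integral>\<^sup>+x\<in>A. ennreal (sd x) \<partial>lborel) \<le> (\<integral>\<^sup>+x. indicator A x \<partial>lborel)"
      using sd_le_1 by (intro nn_integral_mono) (auto simp: indicator_def)
    also have "\<dots> < \<infinity>" using finA by simp
    finally show ?thesis using that by (metis ennreal_cases infinity_ennreal_def less_irrefl)
  qed
  have m_le: "m \<le> mA" using m mA by simp
  \<comment> \<open>The first threshold provides n F (1 - F) \<ge> 2 throughout \<open>A\<close>;
    the second provides sqrt n * \<eta> \<ge> 1.\<close>
  have "eventually (\<lambda>n. 2 / s \<le> real n \<and> (1 / \<eta>)\<^sup>2 \<le> real n) sequentially"
    by (intro eventually_conj eventually_ge_at_top[THEN eventually_compose_filterlim] filterlim_real_sequentially)
  then show ?thesis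
  proof eventually_elim
    case (elim n)
    define Y where "Y \<omega> = sqrt (real n) *\<^sub>R (abs_l1 (emp_quantile n (\<lambda>i. X i \<omega>)) - abs_l1 (quantile F))" for \<omega>
    have Y [measurable]: "Y \<in> borel_measurable M"
      unfolding Y_def by (rule measurable_quantile_process) simp
    have [measurable]: "l1_mass U \<in> borel_measurable borel"
      by (intro borel_measurable_continuous_onI continuous_on_l1_mass U)
    have "0 < 2 / s" using s by simp
    with elim have n: "0 < real n" by linarith
    have "1 / \<eta> \<le> sqrt (real n)" using elim by (intro real_le_rsqrt) simp
    then have n\<eta>: "1 \<le> sqrt (real n) * \<eta>" using \<eta> by (simp add: field_simps)
    define T where "T \<omega> = (\<integral>\<^sup>+x\<in>A. ennreal (min \<bar>emp_process n \<omega> x\<bar> (sd x)) \<partial>lborel)" for \<omega>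
    have T_mA: "T \<omega> \<le> ennreal mA" for \<omega>
      unfolding T_def mA(1)[symmetric]
      by (intro nn_integral_mono) (auto simp: indicator_def intro!: ennreal_leI)
    have T_Y: "T \<omega> \<le> ennreal (l1_mass U (Y \<omega>))" for \<omega>
    proof -
      let ?x = "\<lambda>i. X i \<omega>"
      let ?h = "\<lambda>u. emp_quantile n ?x u - quantile F u"
      have h: "integrable unit_leb ?h" using Q integrable_emp_quantile by simp
      have "T \<omega> \<le> (\<integral>\<^sup>+x. ennreal (sqrt (real n)) * (ennreal (min \<bar>emp_cdf n ?x x - F x\<bar> \<eta>) * indicator A x) \<partial>lborel)"
        unfolding T_def
      proof (rule nn_integral_mono)
        fix x
        \<comment> \<open>Truncation at \<open>sd x\<close> is stronger than truncation at sqrt n *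
          \<eta>, because \<open>sd x\<close> is at most 1.\<close>
        have "min \<bar>emp_process n \<omega> x\<bar> (sd x) \<le> sqrt (real n) * min \<bar>emp_cdf n ?x x - F x\<bar> \<eta>"
          using n\<eta> sd_le_1[of x] by (auto simp: emp_process_def abs_mult min_mult_distrib_left)
        then show "ennreal (min \<bar>emp_process n \<omega> x\<bar> (sd x)) * indicator A x \<le>
            ennreal (sqrt (real n)) * (ennreal (min \<bar>emp_cdf n ?x x - F x\<bar> \<eta>) * indicator A x)"
          using \<eta> by (auto simp: indicator_def ennreal_mult[symmetric] intro!: ennreal_leI)
      qed
      also have "\<dots> = ennreal (sqrt (real n)) * (\<integral>\<^sup>+x\<in>A. ennreal (min \<bar>emp_cdf n ?x x - F x\<bar> \<eta>) \<partial>lborel)"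
        using borel_measurable_mono[OF mono_emp_cdf] by (intro nn_integral_cmult) auto
      also have "\<dots> \<le> ennreal (sqrt (real n)) * (\<integral>\<^sup>+u\<in>U. ennreal \<bar>?h u\<bar> \<partial>unit_leb)"
        using n by (intro mult_left_mono nn_integral_quantile_diff_ge mono_emp_cdf mono_F
            emp_quantile_le_iff D.quantile_cdf_le_iff A U U01 ball) auto
      also have "(\<integral>\<^sup>+u\<in>U. ennreal \<bar>?h u\<bar> \<partial>unit_leb) = (\<integral>\<^sup>+u. ennreal (indicator U u * \<bar>?h u\<bar>) \<partial>unit_leb)"
        by (intro nn_integral_cong) (auto simp: indicator_def)
      also have "\<dots> = ennreal (\<integral>u. indicator U u * \<bar>?h u\<bar> \<partial>unit_leb)"
        using integrable_indicator_abs[OF U h] by (intro nn_integral_eq_integral) auto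
      also have "ennreal (sqrt (real n)) * \<dots> = ennreal (\<integral>u. indicator U u * \<bar>sqrt (real n) * ?h u\<bar> \<partial>unit_leb)"
        by (simp add: ennreal_mult[symmetric] integral_nonneg_AE abs_mult mult.left_commute
            flip: integral_mult_right_zero)
      also have "\<dots> = ennreal (l1_mass U (Y \<omega>))"
      proof -
        have "Y \<omega> = abs_l1 (\<lambda>u. sqrt (real n) * ?h u)"
          unfolding Y_def using Q integrable_emp_quantile h
          by (simp add: minus_l1.abs_eq scaleR_l1.abs_eq L1_eq_def)
        with l1_mass_abs_l1[OF U, of "\<lambda>u. sqrt (real n) * ?h u"] h show ?thesis by simp
      qed
      finally show ?thesis .
    qed
    have Tint: "ennreal (mA / 8) \<le> (\<integral>\<^sup>+\<omega>. T \<omega> \<partial>M)"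
    proof -
      interpret P: pair_sigma_finite M lborel ..
      have "ennreal (mA / 8) = ennreal (1 / 8) * (\<integral>\<^sup>+x\<in>A. ennreal (sd x) \<partial>lborel)"
        using mA by (simp flip: ennreal_mult')
      also have "\<dots> = (\<integral>\<^sup>+x. ennreal (1 / 8) * (ennreal (sd x) * indicator A x) \<partial>lborel)"
        by (rule nn_integral_cmult[symmetric]) simp
      \<comment> \<open>The pointwise moment bound is integrated over \<open>A\<close>; Tonelli then
        moves the expectation outside.\<close>
      also have "\<dots> \<le> (\<integral>\<^sup>+x. \<integral>\<^sup>+\<omega>. ennreal (min \<bar>emp_process n \<omega> x\<bar> (sd x)) * indicator A x \<partial>M \<partial>lborel)"
      proof (rule nn_integral_mono)
        fix x
        show "ennreal (1 / 8) * (ennreal (sd x) * indicator A x) \<le>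
            (\<integral>\<^sup>+\<omega>. ennreal (min \<bar>emp_process n \<omega> x\<bar> (sd x)) * indicator A x \<partial>M)"
        proof (cases "x \<in> A")
          case True
          have "2 \<le> real n * s" using elim s by (simp add: field_simps)
          also have "\<dots> \<le> real n * (F x * (1 - F x))" using s(2)[OF True] by (intro mult_left_mono) auto
          finally have "ennreal (sd x / 8) \<le> ennreal (expectation (\<lambda>\<omega>. min \<bar>emp_process n \<omega> x\<bar> (sd x)))"
            by (intro ennreal_leI expectation_emp_process_ge)
          also have "\<dots> = (\<integral>\<^sup>+\<omega>. ennreal (min \<bar>emp_process n \<omega> x\<bar> (sd x)) \<partial>M)"
          proof (rule nn_integral_eq_integral[symmetric])
            have "(\<lambda>\<omega>. case (\<omega>, x) of (\<omega>, x) \<Rightarrow> emp_process n \<omega> x) \<in> borel_measurable M"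
              by (rule measurable_compose[OF _ measurable_emp_process]) simp
            then have [measurable]: "(\<lambda>\<omega>. emp_process n \<omega> x) \<in> borel_measurable M" by simp
            show "integrable M (\<lambda>\<omega>. min \<bar>emp_process n \<omega> x\<bar> (sd x))"
              using sd_nonneg by (intro integrable_const_bound[where B = "sd x"]) auto
          qed (use sd_nonneg in simp)
          finally show ?thesis using True sd_nonneg[of x] by (simp flip: ennreal_mult')
        qed simp
      qed
      also have "\<dots> = (\<integral>\<^sup>+\<omega>. T \<omega> \<partial>M)"
        unfolding T_def by (rule P.Fubini') measurable
      finally show ?thesis .
    qed
    have mA0: "0 < mA" using m m_le by linarith
    have Tm [measurable]: "T \<in> borel_measurable M"
      unfolding T_def by measurable
    have "ennreal (1 / 8) = ennreal (1 / mA) * ennreal (mA / 8)"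
      using mA0 by (simp flip: ennreal_mult')
    also have "\<dots> \<le> ennreal (1 / mA) * (\<integral>\<^sup>+\<omega>. T \<omega> \<partial>M)"
      by (rule mult_left_mono[OF Tint]) simp
    also have "\<dots> = (\<integral>\<^sup>+\<omega>. ennreal (1 / mA) * T \<omega> \<partial>M)"
      by (rule nn_integral_cmult[symmetric]) simp
    also have "\<dots> \<le> (\<integral>\<^sup>+\<omega>. ennreal (min 1 (l1_mass U (Y \<omega>) / m)) \<partial>M)"
    proof (rule nn_integral_mono)
      fix \<omega>
      obtain t where t: "T \<omega> = ennreal t" "0 \<le> t"
        using T_mA[of \<omega>] by (metis ennreal_cases ennreal_less_top not_le top.extremum_strict)
      have "t \<le> mA" "t \<le> l1_mass U (Y \<omega>)"
        using T_mA[of \<omega>] T_Y[of \<omega>] t mA l1_mass_nonneg by auto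
      moreover have "t / mA \<le> t / m"
        using t m m_le mA0 by (intro divide_left_mono) auto
      moreover have "t / m \<le> l1_mass U (Y \<omega>) / m" if "t \<le> l1_mass U (Y \<omega>)"
        using that m by (intro divide_right_mono) auto
      ultimately have "t / mA \<le> min 1 (l1_mass U (Y \<omega>) / m)"
        using mA0 by auto
      then show "ennreal (1 / mA) * T \<omega> \<le> ennreal (min 1 (l1_mass U (Y \<omega>) / m))"
        using t mA0 by (simp add: ennreal_leI flip: ennreal_mult')
    qed
    also have "\<dots> = ennreal (expectation (\<lambda>\<omega>. min 1 (l1_mass U (Y \<omega>) / m)))"
      using m l1_mass_nonneg
      by (intro nn_integral_eq_integral integrable_const_bound[where B = 1]) (auto simp: min_def)
    finally show ?case
      using m l1_mass_nonneg unfolding Y_def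
      by (subst (asm) ennreal_le_iff) (auto intro!: integral_nonneg_AE)
  qed
qed

text \<open>The truncated ratio is a bounded continuous functional on the space, so the lower bound
  for finite \<open>n\<close> passes to the weak limit.\<close>

lemma limit_l1_mass_ge:
  fixes Z :: "'b \<Rightarrow> l1"
  assumes Q: "integrable unit_leb (quantile F)"
    and conv: "converges_in_distribution M (\<lambda>n \<omega>. sqrt (real n) *\<^sub>R
      (abs_l1 (emp_quantile n (\<lambda>i. X i \<omega>)) - abs_l1 (quantile F))) N Z"
    and A: "A \<in> sets borel" "emeasure lborel A < \<infinity>"
    and s: "0 < s" "\<And>x. x \<in> A \<Longrightarrow> s \<le> F x * (1 - F x)"
    and U: "U \<in> sets borel" "U \<subseteq> {0<..<1}"
    and \<eta>: "0 < \<eta>" "\<And>x. x \<in> A \<Longrightarrow> {F x - \<eta><..<F x + \<eta>} \<subseteq> U"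
    and m: "0 < m" "ennreal m \<le> (\<integral>\<^sup>+x\<in>A. ennreal (sd x) \<partial>lborel)"
  shows "1 / 8 \<le> (\<integral>\<omega>. min 1 (l1_mass U (Z \<omega>) / m) \<partial>N)"
proof (rule tendsto_lowerbound)
  show "(\<lambda>n. expectation (\<lambda>\<omega>. min 1 (l1_mass U
    (sqrt (real n) *\<^sub>R (abs_l1 (emp_quantile n (\<lambda>i. X i \<omega>)) - abs_l1 (quantile F))) / m)))
    \<longlonglongrightarrow> (\<integral>\<omega>. min 1 (l1_mass U (Z \<omega>) / m) \<partial>N)"
  proof -
    have "continuous_on UNIV (\<lambda>f. min 1 (l1_mass U f / m))"
      using m by (intro continuous_intros continuous_on_l1_mass U) auto
    moreover have "bounded (range (\<lambda>f. min 1 (l1_mass U f / m)))"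
      using m l1_mass_nonneg[of U] by (intro boundedI[where B = 1]) (auto simp: abs_le_iff min.bounded_iff intro: order_trans[of _ 0])
    ultimately show ?thesis using conv unfolding converges_in_distribution_def by blast
  qed
qed (use expectation_l1_mass_ge[OF Q A s U \<eta> m] in auto)

section \<open>Consequences for the quantile function\<close>

abbreviation "Q \<equiv> quantile F"

lemma quantile_mono: "0 < u \<Longrightarrow> u \<le> v \<Longrightarrow> v < 1 \<Longrightarrow> Q u \<le> Q v"
  using D.quantile_cdf_le_iff[of u "Q v"] D.quantile_cdf_le_iff[of v "Q v"] by auto

section \<open>A uniform bound on the truncated integrals of the standard deviation\<close>

lemma cdf_vimage_atLeastLessThan:
  assumes "0 < a" "a < 1" "0 < b" "b < 1"
  shows "F -` {a..<b} = {Q a..<Q b}"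
  using D.quantile_cdf_le_iff[of a] D.quantile_cdf_le_iff[of b] assms
  by (auto simp: not_le[symmetric])

text \<open>The norm of \<open>Z\<close> is finite, so for a large level \<open>Suc k\<close> the
  expectation of min(1, norm / level) drops below 1/8. An integral of \<open>sd\<close> exceeding
  that level would contradict the lower bound for the limit. The level does not depend on
  \<epsilon>.\<close>

lemma quantile_limit_integral_bound:
  fixes Z :: "'b \<Rightarrow> l1"
  assumes Q: "integrable unit_leb Q"
    and N: "prob_space N"
    and conv: "converges_in_distribution M (\<lambda>n \<omega>. sqrt (real n) *\<^sub>R
      (abs_l1 (emp_quantile n (\<lambda>i. X i \<omega>)) - abs_l1 Q)) N Z"
  obtains C where "\<And>\<epsilon>. 0 < \<epsilon> \<Longrightarrow> \<epsilon> < 1/2 \<Longrightarrow>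
    (\<integral>\<^sup>+x\<in>F -` {\<epsilon>..<1 - \<epsilon>}. ennreal (sd x) \<partial>lborel) \<le> ennreal C"
proof -
  interpret N: prob_space N by fact
  have [measurable]: "Z \<in> borel_measurable N"
    using conv by (simp add: converges_in_distribution_def)
  have [measurable]: "l1_mass U \<in> borel_measurable borel" if "U \<in> sets borel" for U
    using that by (intro borel_measurable_continuous_onI continuous_on_l1_mass)
  let ?U = "{0<..<1} :: real set"
  have "(\<lambda>k. \<integral>\<omega>. min 1 (l1_mass ?U (Z \<omega>) / real (Suc k)) \<partial>N) \<longlonglongrightarrow> (\<integral>\<omega>. 0 \<partial>N)"
  proof (rule integral_dominated_convergence[where w = "\<lambda>_. 1"])
    show "AE \<omega> in N. (\<lambda>k. min 1 (l1_mass ?U (Z \<omega>) / real (Suc k))) \<longlonglongrightarrow> 0"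
    proof (rule AE_I2)
      fix \<omega>
      have "(\<lambda>k. min 1 (l1_mass ?U (Z \<omega>) / real (Suc k))) \<longlonglongrightarrow> min 1 0"
        by (intro tendsto_min tendsto_const LIMSEQ_Suc lim_const_over_n)
      then show "(\<lambda>k. min 1 (l1_mass ?U (Z \<omega>) / real (Suc k))) \<longlonglongrightarrow> 0" by simp
    qed
  qed (use l1_mass_nonneg in \<open>auto simp: abs_le_iff min.bounded_iff intro: order_trans[of _ 0]\<close>)
  then have "eventually (\<lambda>k. (\<integral>\<omega>. min 1 (l1_mass ?U (Z \<omega>) / real (Suc k)) \<partial>N) < 1 / 8) sequentially"
    by (rule order_tendstoD) simp
  then obtain k where k: "(\<integral>\<omega>. min 1 (l1_mass ?U (Z \<omega>) / real (Suc k)) \<partial>N) < 1 / 8"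
    using eventually_happens'[OF sequentially_bot] by blast
  have "(\<integral>\<^sup>+x\<in>F -` {\<epsilon>..<1 - \<epsilon>}. ennreal (sd x) \<partial>lborel) \<le> ennreal (real (Suc k))"
    if \<epsilon>: "0 < \<epsilon>" "\<epsilon> < 1/2" for \<epsilon>
  proof (rule ccontr)
    assume "\<not> ?thesis"
    then have m: "ennreal (real (Suc k)) \<le> (\<integral>\<^sup>+x\<in>F -` {\<epsilon>..<1 - \<epsilon>}. ennreal (sd x) \<partial>lborel)"
      by simp
    have A: "F -` {\<epsilon>..<1 - \<epsilon>} = {Q \<epsilon>..<Q (1 - \<epsilon>)}"
      using \<epsilon> by (intro cdf_vimage_atLeastLessThan) auto
    have "1 / 8 \<le> (\<integral>\<omega>. min 1 (l1_mass ?U (Z \<omega>) / real (Suc k)) \<partial>N)"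
    \<comment> \<open>The choice is U = (0,1), neighbourhood radius \<epsilon> and variance bound
      \<epsilon>^2. The set \<open>A\<close> is a bounded interval, hence of finite measure.\<close>
    proof (rule limit_l1_mass_ge[OF Q conv _ _ _ _ _ _ _ _ _ m])
      show "F -` {\<epsilon>..<1 - \<epsilon>} \<in> sets borel" "emeasure lborel (F -` {\<epsilon>..<1 - \<epsilon>}) < \<infinity>"
        unfolding A using quantile_mono[of \<epsilon> "1 - \<epsilon>"] \<epsilon> by (auto simp: emeasure_lborel_Ico)
      show "0 < \<epsilon> * \<epsilon>" "0 < \<epsilon>" using \<epsilon> by auto
      show "\<epsilon> * \<epsilon> \<le> F x * (1 - F x)" if "x \<in> F -` {\<epsilon>..<1 - \<epsilon>}" for x
        using that \<epsilon> by (intro mult_mono) auto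
    qed auto
    with k show False by simp
  qed
  then show ?thesis by (rule that)
qed

section \<open>The Stieltjes measure as an image of Lebesgue measure\<close>

text \<open>The preimage of [a,b) under \<open>F\<close> is [Q a, Q b), so both measures agree on
  the intersection-stable generator of half-open intervals. Uniqueness follows from an exhaustion by
  intervals of finite measure.\<close>

lemma stieltjes01_quantile_eq_distr:
  "stieltjes01 Q = distr (restrict_space lborel (F -` {0<..<1})) (restrict_space borel {0<..<1}) F"
    (is "_ = ?R")
proof -
  let ?E = "(\<lambda>(a, b). {a..<b}) ` {(a, b). 0 < a \<and> a \<le> b \<and> b < (1::real)}"
  have sub: "?E \<subseteq> Pow {0<..<1}" by auto
  have sets: "sets (stieltjes01 Q) = sigma_sets {0<..<1} ?E"
    unfolding stieltjes01_def by (rule sets_extend_measure[OF sub])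
  have [measurable]: "F -` {0<..<1} \<in> sets borel"
    using measurable_sets[OF measurable_F, of "{0<..<1}"] by simp
  have meas: "F \<in> restrict_space lborel (F -` {0<..<1}) \<rightarrow>\<^sub>M restrict_space borel {0<..<1}"
    by (intro measurable_restrict_space3) auto
  show ?thesis
  proof (rule measure_eqI_generator_eq[where E = ?E and \<Omega> = "{0<..<1}" and
        A = "\<lambda>n. {1 / real (n + 2)..<1 - 1 / real (n + 2)}"])
    show "Int_stable ?E"
    proof (rule Int_stableI_image, safe)
      fix a b c d :: real
      assume *: "0 < a" "a \<le> b" "b < 1" "0 < c" "c \<le> d" "d < 1"
      show "\<exists>k\<in>{(a, b). 0 < a \<and> a \<le> b \<and> b < 1}. {a..<b} \<inter> {c..<d} = (case k of (a, b) \<Rightarrow> {a..<b})"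
      proof (cases "max a c \<le> min b d")
        case True
        then show ?thesis using * by (intro bexI[of _ "(max a c, min b d)"]) auto
      next
        case False
        \<comment> \<open>Disjoint intervals meet in the empty set, which the degenerate pair
          represents.\<close>
        then show ?thesis using * by (intro bexI[of _ "(a, a)"]) auto
      qed
    qed
    show "?E \<subseteq> Pow {0<..<1}" by (rule sub)
    show "sets (stieltjes01 Q) = sigma_sets {0<..<1} ?E" by (rule sets)
    show "sets ?R = sigma_sets {0<..<1} ?E"
      using sets by (simp add: sets_stieltjes01)
    show "emeasure (stieltjes01 Q) V = emeasure ?R V" if E: "V \<in> ?E" for V
    proof -
      obtain a b where V: "V = {a..<b}" "0 < a" "a \<le> b" "b < 1" using E by auto
      have "V \<in> sets (restrict_space borel {0<..<1})"
        using V by (auto simp: sets_restrict_space intro!: image_eqI[of _ _ V])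
      then have "emeasure ?R V = emeasure lborel (F -` V)"
        using V by (subst emeasure_distr[OF meas]) (auto simp: space_restrict_space emeasure_restrict_space intro!: arg_cong2[where f = emeasure])
      also have "\<dots> = ennreal (Q b - Q a)"
        using V quantile_mono[of a b] cdf_vimage_atLeastLessThan[of a b] by simp
      also have "\<dots> = emeasure (stieltjes01 Q) V"
        using V D.emeasure_stieltjes01_quantile[of a b] by simp
      finally show ?thesis ..
    qed
    have *: "1 / real (n + 2) \<le> 1 - 1 / real (n + 2)" for n by (simp add: field_simps)
    show "range (\<lambda>n. {1 / real (n + 2)..<1 - 1 / real (n + 2)}) \<subseteq> ?E"
    proof (rule image_subsetI)
      fix n
      show "{1 / real (n + 2)..<1 - 1 / real (n + 2)} \<in> ?E"
        using *[of n] by (intro image_eqI[of _ _ "(1 / real (n + 2), 1 - 1 / real (n + 2))"]) auto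
    qed
    show "emeasure (stieltjes01 Q) {1 / real (n + 2)..<1 - 1 / real (n + 2)} \<noteq> \<infinity>" for n
      using * by (subst D.emeasure_stieltjes01_quantile) auto
    show "(\<Union>n. {1 / real (n + 2)..<1 - 1 / real (n + 2)}) = {0<..<1::real}"
    proof (intro equalityI subsetI)
      fix u :: real assume "u \<in> {0<..<1}"
      then obtain n where n: "1 / real (Suc n) < min u (1 - u)"
        using nat_approx_posE[of "min u (1 - u)"] by auto
      moreover have "1 / real (n + 2) \<le> 1 / real (Suc n)"
        by (intro divide_left_mono) auto
      ultimately show "u \<in> (\<Union>n. {1 / real (n + 2)..<1 - 1 / real (n + 2)})"
        by (intro UN_I[of n]) auto
    next
      fix u assume "u \<in> (\<Union>n. {1 / real (n + 2)..<1 - 1 / real (n + 2)})"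
      then obtain n where "1 / real (n + 2) \<le> u" "u < 1 - 1 / real (n + 2)" by auto
      moreover have "0 < 1 / real (n + 2)" by simp
      ultimately show "u \<in> {0<..<1}" unfolding greaterThanLessThan_iff by linarith
    qed
  qed
qed

text \<open>The change of variables u = \<open>F x\<close> turns the Stieltjes integral into the
  Lebesgue integral of \<open>sd\<close> over the points with 0 < F < 1. Monotone convergence along
  an exhaustion of (0,1) then preserves the uniform bound.\<close>

lemma stieltjes01_integral_finite:
  assumes C: "\<And>\<epsilon>. 0 < \<epsilon> \<Longrightarrow> \<epsilon> < 1/2 \<Longrightarrow>
    (\<integral>\<^sup>+x\<in>F -` {\<epsilon>..<1 - \<epsilon>}. ennreal (sd x) \<partial>lborel) \<le> ennreal C"
  shows "(\<integral>\<^sup>+ u. ennreal (sqrt (u * (1 - u))) \<partial>stieltjes01 Q) < \<infinity>"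
proof -
  have V [measurable]: "F -` S \<in> sets borel" if "S \<in> sets borel" for S
    using measurable_sets[OF measurable_F that] by simp
  have meas: "F \<in> restrict_space lborel (F -` {0<..<1}) \<rightarrow>\<^sub>M restrict_space borel {0<..<1}"
    by (intro measurable_restrict_space3) auto
  \<comment> \<open>The shift by 3 keeps the cut-off strictly below 1/2 already for
    \<open>n = 0\<close>, as the hypothesis demands.\<close>
  define J :: "nat \<Rightarrow> real set" where "J n = {1 / real (n + 3)..<1 - 1 / real (n + 3)}" for n
  have "(\<integral>\<^sup>+ u. ennreal (sqrt (u * (1 - u))) \<partial>stieltjes01 Q) =
      (\<integral>\<^sup>+ x. ennreal (sqrt (F x * (1 - F x))) \<partial>restrict_space lborel (F -` {0<..<1}))"
    unfolding stieltjes01_quantile_eq_distr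
    by (rule nn_integral_distr[OF meas]) (simp add: measurable_restrict_space1)
  also have "\<dots> = (\<integral>\<^sup>+x\<in>F -` {0<..<1}. ennreal (sd x) \<partial>lborel)"
    by (subst nn_integral_restrict_space) (simp_all add: sd_def)
  also have "\<dots> = (\<integral>\<^sup>+x. (SUP n. ennreal (sd x) * indicator (F -` J n) x) \<partial>lborel)"
  proof (rule nn_integral_cong)
    fix x
    show "ennreal (sd x) * indicator (F -` {0<..<1}) x = (SUP n. ennreal (sd x) * indicator (F -` J n) x)"
    proof (cases "F x \<in> {0<..<1}")
      case True
      then obtain n where n: "1 / real (Suc n) < min (F x) (1 - F x)"
        using nat_approx_posE[of "min (F x) (1 - F x)"] by auto
      moreover have "1 / real (n + 3) \<le> 1 / real (Suc n)"
        by (intro divide_left_mono) auto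
      ultimately have "F x \<in> J n" by (auto simp: J_def)
      then show ?thesis using True
        by (intro antisym SUP_upper2[of n] SUP_least) (auto simp: indicator_def)
    next
      case False
      have "F x \<notin> J n" for n
      proof
        assume "F x \<in> J n"
        then have "1 / real (n + 3) \<le> F x" "F x < 1 - 1 / real (n + 3)" by (auto simp: J_def)
        moreover have "0 < 1 / real (n + 3)" by simp
        ultimately show False using False unfolding greaterThanLessThan_iff by linarith
      qed
      with False show ?thesis by simp
    qed
  qed
  also have "\<dots> = (SUP n. \<integral>\<^sup>+x. ennreal (sd x) * indicator (F -` J n) x \<partial>lborel)"
  proof (rule nn_integral_monotone_convergence_SUP)
    have "J n \<subseteq> J (Suc n)" for n
    proof -
      have "1 / real (Suc n + 3) \<le> 1 / real (n + 3)" by (intro divide_left_mono) auto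
      then show ?thesis unfolding J_def by auto
    qed
    then show "incseq (\<lambda>n x. ennreal (sd x) * indicator (F -` J n) x)"
      by (intro incseq_SucI le_funI mult_left_mono) (auto simp: indicator_def)
    show "(\<lambda>x. ennreal (sd x) * indicator (F -` J n) x) \<in> borel_measurable lborel" for n
      unfolding J_def by measurable
  qed
  also have "\<dots> \<le> ennreal C"
    unfolding J_def by (intro SUP_least C) (auto simp: field_simps)
  finally show ?thesis by (rule le_less_trans) simp
qed

section \<open>Local absolute continuity\<close>

text \<open>Failure of absolute continuity gives interval families of vanishing total length over
  which \<open>Q\<close> increases by at least a fixed amount. Their images under \<open>Q\<close>
  carry a fixed amount of \<open>sd\<close>, so the limit would keep mass on sets \<open>U k\<close>
  of vanishing measure.\<close>

lemma locally_abs_continuous01_quantile: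
  fixes Z :: "'b \<Rightarrow> l1"
  assumes Q: "integrable unit_leb Q"
    and N: "prob_space N"
    and conv: "converges_in_distribution M (\<lambda>n \<omega>. sqrt (real n) *\<^sub>R
      (abs_l1 (emp_quantile n (\<lambda>i. X i \<omega>)) - abs_l1 Q)) N Z"
  shows "locally_abs_continuous01 Q"
proof (rule ccontr)
  interpret N: prob_space N by fact
  have [measurable]: "Z \<in> borel_measurable N"
    using conv by (simp add: converges_in_distribution_def)
  have [measurable]: "l1_mass U \<in> borel_measurable borel" if "U \<in> sets borel" for U
    using that by (intro borel_measurable_continuous_onI continuous_on_l1_mass)
  assume "\<not> locally_abs_continuous01 Q"
  then obtain a b where ab: "0 < a" "a \<le> b" "b < 1" and "\<not> abs_continuous_on {a..b} Q"
    unfolding locally_abs_continuous01_def by blast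
  define P :: "real \<Rightarrow> (real \<times> real) set \<Rightarrow> bool" where "P \<delta> D \<longleftrightarrow> finite D \<and>
      (\<forall>(c, d)\<in>D. c \<le> d \<and> {c..d} \<subseteq> {a..b}) \<and> disjoint_family_on (\<lambda>(c, d). {c<..<d}) D \<and>
      (\<Sum>(c, d)\<in>D. d - c) < \<delta>" for \<delta> D
  have "\<not> (\<forall>\<epsilon>>0. \<exists>\<delta>>0. \<forall>D. P \<delta> D \<longrightarrow> (\<Sum>(c, d)\<in>D. \<bar>Q d - Q c\<bar>) < \<epsilon>)"
    using \<open>\<not> abs_continuous_on {a..b} Q\<close> unfolding abs_continuous_on_def P_def by (simp only: imp_conjL simp_thms)
  then obtain \<epsilon> where \<epsilon>: "0 < \<epsilon>"
    and *: "\<And>\<delta>. 0 < \<delta> \<Longrightarrow> \<exists>D. P \<delta> D \<and> \<epsilon> \<le> (\<Sum>(c, d)\<in>D. \<bar>Q d - Q c\<bar>)"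
    by (meson not_le)
  have "\<exists>D. P ((1/2) ^ Suc k) D \<and> \<epsilon> \<le> (\<Sum>(c, d)\<in>D. \<bar>Q d - Q c\<bar>)" for k :: nat
    by (rule *) simp
  then obtain D where PD: "\<And>k. P ((1/2) ^ Suc k) (D k)"
    and var: "\<And>k. \<epsilon> \<le> (\<Sum>(c, d)\<in>D k. \<bar>Q d - Q c\<bar>)"
    by metis
  have fin: "\<And>k. finite (D k)"
    and D: "\<And>k c d. (c, d) \<in> D k \<Longrightarrow> c \<le> d \<and> {c..d} \<subseteq> {a..b}"
    and disj: "\<And>k. disjoint_family_on (\<lambda>(c, d). {c<..<d}) (D k)"
    and len: "\<And>k. (\<Sum>(c, d)\<in>D k. d - c) < (1/2) ^ Suc k"
    using PD unfolding P_def by blast+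
  have D01: "0 < c" "c \<le> d" "d < 1" "a \<le> c" "d \<le> b" if "(c, d) \<in> D k" for k c d
    using D[OF that] ab by auto
  \<comment> \<open>On \<open>A k\<close> the value \<open>F x\<close> lies in [a,b], so
    \<open>s\<close> bounds the variance from below. Since \<open>A k\<close> has measure at least
    \<epsilon>, \<open>m\<close> bounds the integral of \<open>sd\<close>.\<close>
  define s where "s = a * (1 - b)"
  define m where "m = sqrt s * \<epsilon>"
  have s: "0 < s" and m: "0 < m" using ab \<epsilon> by (auto simp: s_def m_def)
  \<comment> \<open>Widening every interval by this amount on both sides adds at most half of
    (1/2)^k in total; the added 1 keeps the denominator positive for any cardinality.\<close>
  define \<eta> where "\<eta> k = (1/2) ^ Suc k / (2 * (real (card (D k)) + 1))" for k
  have \<eta>: "0 < \<eta> k" for k unfolding \<eta>_def by (intro divide_pos_pos) auto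
  define U where "U k = (\<Union>(c, d)\<in>D k. {c - \<eta> k<..<d + \<eta> k}) \<inter> {0<..<1}" for k
  define A where "A k = (\<Union>(c, d)\<in>D k. {Q c..<Q d})" for k
  have Q_iff: "Q c \<le> x \<longleftrightarrow> c \<le> F x" "x < Q d \<longleftrightarrow> F x < d" if "(c, d) \<in> D k" for c d k x
    using D.quantile_cdf_le_iff[of c x] D.quantile_cdf_le_iff[of d x] D01[OF that]
    by (auto simp: not_le[symmetric])
  have A_iff: "x \<in> A k \<longleftrightarrow> (\<exists>(c, d)\<in>D k. c \<le> F x \<and> F x < d)" for x k
    unfolding A_def UN_iff by (rule bex_cong[OF refl]) (auto simp: Q_iff)
  have Ub: "U k \<in> sets borel" for k
    unfolding U_def using fin by (intro sets.Int sets.finite_UN) auto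
  have U01: "U k \<subseteq> {0<..<1}" for k unfolding U_def by auto
  have Usmall: "measure lborel (U k) \<le> (1/2) ^ k" for k
  proof -
    have "emeasure lborel (U k) \<le> emeasure lborel (\<Union>(c, d)\<in>D k. {c - \<eta> k<..<d + \<eta> k})"
      using fin by (intro emeasure_mono sets.finite_UN) (auto simp: U_def)
    also have "\<dots> \<le> (\<Sum>p\<in>D k. emeasure lborel (case p of (c, d) \<Rightarrow> {c - \<eta> k<..<d + \<eta> k}))"
      using fin by (intro emeasure_subadditive_finite) auto
    also have "\<dots> = (\<Sum>p\<in>D k. ennreal (case p of (c, d) \<Rightarrow> d - c + 2 * \<eta> k))"
      using D01(2) \<eta>[of k] by (intro sum.cong refl) (force simp: emeasure_lborel_Ioo)
    also have "\<dots> = ennreal (\<Sum>p\<in>D k. case p of (c, d) \<Rightarrow> d - c + 2 * \<eta> k)"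
      using D01(2) \<eta>[of k] by (intro sum_ennreal) fastforce
    also have "(\<Sum>p\<in>D k. case p of (c, d) \<Rightarrow> d - c + 2 * \<eta> k) =
        (\<Sum>(c, d)\<in>D k. d - c) + real (card (D k)) * (2 * \<eta> k)"
      by (simp add: case_prod_beta sum.distrib)
    also have "\<dots> \<le> (1/2) ^ Suc k + (1/2) ^ Suc k"
    proof (rule add_mono)
      have "c * (2 * (p / (2 * (c + 1)))) \<le> p" if "0 \<le> c" "0 \<le> p" for c p :: real
        using that by (simp add: field_simps)
      then show "real (card (D k)) * (2 * \<eta> k) \<le> (1/2) ^ Suc k"
        unfolding \<eta>_def by (metis of_nat_0_le_iff zero_le_divide_1_iff zero_le_numeral zero_le_power)
    qed (use len[of k] in simp)
    also have "(1/2) ^ Suc k + (1/2) ^ Suc k = (1/2 :: real) ^ k" by simp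
    finally have "emeasure lborel (U k) \<le> ennreal ((1/2) ^ k)" by (simp add: ennreal_leI)
    then show ?thesis by (simp add: measure_def enn2real_leI)
  qed
  have "1 / 8 \<le> (\<integral>\<omega>. min 1 (l1_mass (U k) (Z \<omega>) / m) \<partial>N)" for k
  proof (rule limit_l1_mass_ge[OF Q conv _ _ s _ Ub U01 _ _ m])
    \<comment> \<open>The further minimum with \<open>a\<close> and \<open>1 - b\<close> keeps the
      neighbourhoods of values in [a,b] inside (0,1).\<close>
    let ?\<eta> = "min (\<eta> k) (min a (1 - b))"
    show "0 < ?\<eta>" using \<eta>[of k] ab by simp
    show [measurable]: "A k \<in> sets borel"
      unfolding A_def using fin by (intro sets.finite_UN) auto
    have fin_Q: "emeasure lborel (case p of (c, d) \<Rightarrow> {Q c..<Q d}) < \<infinity>" if "p \<in> D k" for p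
      using that D01[of "fst p" "snd p" k] quantile_mono[of "fst p" "snd p"] by (simp add: case_prod_beta)
    have "emeasure lborel (A k) \<le> (\<Sum>p\<in>D k. emeasure lborel (case p of (c, d) \<Rightarrow> {Q c..<Q d}))"
      unfolding A_def using fin by (intro emeasure_subadditive_finite) auto
    also have "\<dots> < \<infinity>"
      using fin_Q fin[of k] unfolding infinity_ennreal_def by (subst ennreal_sum_less_top) auto
    finally show "emeasure lborel (A k) < \<infinity>" .
    show sF: "s \<le> F x * (1 - F x)" if x: "x \<in> A k" for x
    proof -
      obtain c d where cd: "(c, d) \<in> D k" "c \<le> F x" "F x < d" using x unfolding A_iff by blast
      have "a \<le> F x" "1 - b \<le> 1 - F x" using cd D01[OF cd(1)] by linarith+
      then show ?thesis unfolding s_def using ab by (intro mult_mono) auto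
    qed
    show "{F x - ?\<eta><..<F x + ?\<eta>} \<subseteq> U k" if x: "x \<in> A k" for x
    proof
      fix u assume u: "u \<in> {F x - ?\<eta><..<F x + ?\<eta>}"
      obtain c d where cd: "(c, d) \<in> D k" "c \<le> F x" "F x < d" using x unfolding A_iff by blast
      have "?\<eta> \<le> \<eta> k" "?\<eta> \<le> a" "?\<eta> \<le> 1 - b" by auto
      with u cd D01[OF cd(1)] have "u \<in> {c - \<eta> k<..<d + \<eta> k}" "u \<in> {0<..<1}"
        unfolding greaterThanLessThan_iff by linarith+
      with cd(1) show "u \<in> U k" unfolding U_def by blast
    qed
    \<comment> \<open>A common point \<open>x\<close> would put \<open>F x\<close> in two half-open
      intervals [c,d). A point slightly to the right of \<open>F x\<close> would then lie in both
      open intervals, which are disjoint. Additivity thus gives \<open>A k\<close> the total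
      variation as its measure.\<close>
    have "disjoint_family_on (\<lambda>(c, d). {Q c..<Q d}) (D k)"
    proof (unfold disjoint_family_on_def, intro ballI impI equals0I)
      fix p q x
      assume D: "p \<in> D k" "q \<in> D k" and ne: "p \<noteq> q"
        and x: "x \<in> (case p of (c, d) \<Rightarrow> {Q c..<Q d}) \<inter> (case q of (c, d) \<Rightarrow> {Q c..<Q d})"
      have "F x \<in> {fst p..<snd p}" "F x \<in> {fst q..<snd q}"
        using x D Q_iff[of "fst p" "snd p" k] Q_iff[of "fst q" "snd q" k] by (auto simp: case_prod_beta)
      moreover from this obtain y where "F x < y" "y < min (snd p) (snd q)"
        using dense[of "F x" "min (snd p) (snd q)"] by auto
      ultimately have "y \<in> (case p of (c, d) \<Rightarrow> {c<..<d}) \<inter> (case q of (c, d) \<Rightarrow> {c<..<d})"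
        by (auto simp: case_prod_beta)
      with disjoint_family_onD[OF disj D ne] show False by blast
    qed
    then have "emeasure lborel (A k) = (\<Sum>p\<in>D k. emeasure lborel (case p of (c, d) \<Rightarrow> {Q c..<Q d}))"
      unfolding A_def using fin by (intro sum_emeasure[symmetric]) auto
    also have "\<dots> = (\<Sum>p\<in>D k. ennreal (case p of (c, d) \<Rightarrow> \<bar>Q d - Q c\<bar>))"
    proof (rule sum.cong[OF refl])
      fix p assume "p \<in> D k"
      then show "emeasure lborel (case p of (c, d) \<Rightarrow> {Q c..<Q d}) = ennreal (case p of (c, d) \<Rightarrow> \<bar>Q d - Q c\<bar>)"
        using D01[of "fst p" "snd p" k] quantile_mono[of "fst p" "snd p"] by (simp add: case_prod_beta)
    qed
    also have "\<dots> = ennreal (\<Sum>(c, d)\<in>D k. \<bar>Q d - Q c\<bar>)"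
      by (intro sum_ennreal) auto
    finally have "ennreal \<epsilon> \<le> emeasure lborel (A k)"
      using var[of k] by (simp add: ennreal_leI)
    then have "ennreal m \<le> ennreal (sqrt s) * emeasure lborel (A k)"
      using s \<epsilon> by (simp add: m_def ennreal_mult mult_left_mono)
    also have "\<dots> = (\<integral>\<^sup>+x\<in>A k. ennreal (sqrt s) \<partial>lborel)"
      by (simp add: nn_integral_cmult_indicator)
    also have "\<dots> \<le> (\<integral>\<^sup>+x\<in>A k. ennreal (sd x) \<partial>lborel)"
      using sF by (intro nn_integral_mono) (auto simp: indicator_def sd_def intro!: ennreal_leI)
    finally show "ennreal m \<le> (\<integral>\<^sup>+x\<in>A k. ennreal (sd x) \<partial>lborel)" .
  qed
  \<comment> \<open>The measure of \<open>U k\<close> is at most (1/2)^k, so the mass of each value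
    of \<open>Z\<close> there tends to 0; the truncation at 1 supplies the dominating
    function.\<close>
  moreover have "(\<lambda>k. \<integral>\<omega>. min 1 (l1_mass (U k) (Z \<omega>) / m) \<partial>N) \<longlonglongrightarrow> (\<integral>\<omega>. 0 \<partial>N)"
  proof (rule integral_dominated_convergence[where w = "\<lambda>_. 1"])
    show "AE \<omega> in N. (\<lambda>k. min 1 (l1_mass (U k) (Z \<omega>) / m)) \<longlonglongrightarrow> 0"
    proof (rule AE_I2)
      fix \<omega>
      have "(\<lambda>k. min 1 (l1_mass (U k) (Z \<omega>) / m)) \<longlonglongrightarrow> min 1 (0 / m)"
        using m by (intro tendsto_intros l1_mass_tendsto_0 Ub U01 Usmall) auto
      then show "(\<lambda>k. min 1 (l1_mass (U k) (Z \<omega>) / m)) \<longlonglongrightarrow> 0" by simp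
    qed
  qed (use Ub m l1_mass_nonneg in \<open>auto simp: abs_le_iff min.bounded_iff intro: order_trans[of _ 0]\<close>)
  ultimately have "1 / 8 \<le> (\<integral>\<omega>. (0 :: real) \<partial>N)"
    by (intro LIMSEQ_le_const) auto
  then show False by simp
qed

end

theorem theorem3p2:
  fixes M :: "'a measure" and X :: "nat \<Rightarrow> 'a \<Rightarrow> real"
    and F Q :: "real \<Rightarrow> real"
    and N :: "'b measure" and Z :: "'b \<Rightarrow> l1"
  assumes "prob_space M"
    and "prob_space.indep_vars M (\<lambda>_. borel) X UNIV"
    and "\<And>i. cdf (distr M borel (X i)) = F"
    and "Q = quantile F"
    and "integrable unit_leb Q"
    and "prob_space N"
    and "converges_in_distribution M
           (\<lambda>n \<omega>. sqrt (real n) *\<^sub>R (abs_l1 (emp_quantile n (\<lambda>i. X i \<omega>)) - abs_l1 Q)) N Z"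
  shows "locally_abs_continuous01 Q \<and>
         (\<integral>\<^sup>+ u. ennreal (sqrt (u * (1 - u))) \<partial>stieltjes01 Q) < \<infinity>"
proof -
  interpret M: prob_space M by fact
  interpret iid_sample M X F
    by unfold_locales (use assms in auto)
  note Q = assms(5)[unfolded assms(4)] and conv = assms(7)[unfolded assms(4)]
  obtain C where "\<And>\<epsilon>. 0 < \<epsilon> \<Longrightarrow> \<epsilon> < 1/2 \<Longrightarrow>
      (\<integral>\<^sup>+x\<in>F -` {\<epsilon>..<1 - \<epsilon>}. ennreal (sd x) \<partial>lborel) \<le> ennreal C"
    using quantile_limit_integral_bound[OF Q assms(6) conv] by blast
  then have "(\<integral>\<^sup>+ u. ennreal (sqrt (u * (1 - u))) \<partial>stieltjes01 (quantile F)) < \<infinity>"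
    by (rule stieltjes01_integral_finite)
  with locally_abs_continuous01_quantile[OF Q assms(6) conv] show ?thesis
    unfolding assms(4) ..
qed

end
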